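(* Let $G$ be a measurable groupoid over $X$, $\delta:G\to\mathbb R$ a modular function, and $\hat\nu$ a transverse function (Haar system) on $G$ with $\int\hat\nu^y(dr)\neq 0$ for all $y$. Suppose that the probability $M$ on $G^0$ is quasi-invariant for $\delta$ and $\hat\nu$. Define $\Lambda$ in the following way: given a transverse function $\nu$, there exists a kernel $\rho$ such that $\nu=\hat\nu*\rho$; set $$\Lambda(\nu)=\int\int\delta(x,y)^{-1}\,\rho^y(dx)\,dM(y).$$ Then $\Lambda$ is well defined and it is a transverse measure (over the modular function $\delta$).
   Context: $X$ is one of $\{1,\dots,d\}^{\mathbb N}$, $\{1,\dots,d\}^{\mathbb Z}$, $(S^1)^{\mathbb N}$, $S^1\times S^1$; $\sim$ is an equivalence relation on $X$, $[y]$ is the class of $y$, and $G=\{(x,y)\in X\times X: x\sim y\}$ with the topology and Borel $\sigma$-algebra $\mathcal B$ induced by the product topology of $X\times X$. $G$ is a measurable groupoid: the maps $(x,y)\mapsto x$, $(x,y)\mapsto y$, $(x,y)\mapsto(y,x)$ and $((x,s),(s,y))\mapsto(x,y)$ are measurable. $G^0=\{(x,x)\}$ is identified with $X$. A ($G$-)kernel $\nu$ is a map from $G^0$ to measures over $\mathcal B$ such that for each $y$ the measure $\nu^y$ has support on $[y]$ (so it is integrated as $\int f(s,y)\,\nu^y(ds)$), and for each $A\in\mathcal B$ the map $y\mapsto\nu^y(A)$ is measurable. A transverse function (Haar system) is a kernel $\nu$ such that, if $x\sim y$, the finite measures $\nu^x$ and $\nu^y$ are the same; $\mathcal E^+$ is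 the set of transverse functions. For a kernel $\lambda$ and a function $g$ on $G$, $g\lambda$ is given by $(g\lambda)^x(ds)=g(s,x)\,\lambda^x(ds)$. The convolution of kernels is $(\lambda_1*\lambda_2)^y(ds)=\int\lambda_2^x(ds)\,\lambda_1^y(dx)$, i.e. it sends $f$ to $y\mapsto\int\big(\int f(s,y)\,\lambda_2^x(ds)\big)\lambda_1^y(dx)$. A modular function is a function $\delta:G\to\mathbb R$ with $\delta(x,z)=\delta(x,y)\,\delta(y,z)$ for all $(x,y),(y,z)\in G$; one uses $\delta(y,y)=1$ and $\delta(y,x)=\delta(x,y)^{-1}$. A probability $M$ on $G^0$ is quasi-invariant for $\delta$ and $\hat\nu$ if for any (integrable) $f(x,y)$ on $G$ $$\int\int f(y,x)\,\hat\nu^y(dx)\,dM(y)=\int\int f(x,y)\,\delta(x,y)^{-1}\,\hat\nu^y(dx)\,dM(y).$$ A transverse measure over the modular function $\delta$ is a linear function $\Lambda:\mathcal E^+\to\mathbb R^+$ such that, for each kernel $\lambda$ with $\int\lambda^y(dx)=1$ for all $y$, if $\nu_1,\nu_2$ are transverse functions with $\nu_1*(\delta\lambda)=\nu_2$, then $\Lambda(\nu_1)=\Lambda(\nu_2)$.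
   Formalization: Λ takes values in [0,∞] rather than ℝ⁺, since the defining integral can be infinite for a transverse function of finite measures; the modular function δ is assumed measurable and positive, as otherwise Λ can be negative and δλ need not be a kernel of measures. *)

theory Defs
  imports "HOL-Probability.Probability"
begin

text \<open>The four admissible spaces have different types, so \<open>X\<close> is described up to homeomorphism.\<close>

definition base_space :: "'a::topological_space set \<Rightarrow> bool" where
  "base_space X \<longleftrightarrow>
     (\<exists>d::nat. 1 \<le> d \<and>
        top_of_set X homeomorphic_space
          product_topology (\<lambda>_. discrete_topology {1..d}) (UNIV :: nat set)) \<or>
     (\<exists>d::nat. 1 \<le> d \<and>
        top_of_set X homeomorphic_space
          product_topology (\<lambda>_. discrete_topology {1..d}) (UNIV :: int set)) \<or>
     top_of_set X homeomorphic_space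
       product_topology (\<lambda>_. top_of_set (sphere (0::complex) 1)) (UNIV :: nat set) \<or>
     top_of_set X homeomorphic_space
       prod_topology (top_of_set (sphere (0::complex) 1)) (top_of_set (sphere (0::complex) 1))"

abbreviation borel_on :: "'a::topological_space set \<Rightarrow> 'a measure" where
  "borel_on S \<equiv> restrict_space borel S"

text \<open>The groupoid is the equivalence relation itself, as a set of pairs; the unit space
  \<open>G\<^sup>0\<close> is identified with \<open>X\<close>.\<close>

definition measurable_groupoid :: "'a::topological_space set \<Rightarrow> ('a \<times> 'a) set \<Rightarrow> bool" where
  "measurable_groupoid X G \<longleftrightarrow>
     equiv X G \<and>
     fst \<in> borel_on G \<rightarrow>\<^sub>M borel_on X \<and>
     snd \<in> borel_on G \<rightarrow>\<^sub>M borel_on X \<and>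
     prod.swap \<in> borel_on G \<rightarrow>\<^sub>M borel_on G \<and>
     (\<lambda>(g, h). (fst g, snd h)) \<in>
       borel_on {(g, h). g \<in> G \<and> h \<in> G \<and> snd g = fst h} \<rightarrow>\<^sub>M borel_on G"

text \<open>The measure \<open>\<nu> y\<close> lives on the Borel sets of \<open>G\<close> and is carried by the arrows
  \<open>(s, y)\<close> with \<open>s\<close> in the class of \<open>y\<close>, so integrating \<open>f (s, y)\<close> in \<open>s\<close> against \<open>\<nu> y\<close>
  means integrating \<open>f\<close> on \<open>G\<close>.  The class of \<open>y\<close> need not be a Borel subset of \<open>X\<close>,
  which is why \<open>\<nu> y\<close> is not a measure on \<open>X\<close>.  Values of a kernel off \<open>X\<close> carry no
  information, hence kernels are only ever compared on \<open>X\<close>.\<close>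

definition kernel ::
  "'a::topological_space set \<Rightarrow> ('a \<times> 'a) set \<Rightarrow> ('a \<Rightarrow> ('a \<times> 'a) measure) \<Rightarrow> bool" where
  "kernel X G \<nu> \<longleftrightarrow>
     (\<forall>y\<in>X. sets (\<nu> y) = sets (borel_on G) \<and> (AE g in \<nu> y. snd g = y)) \<and>
     (\<forall>A \<in> sets (borel_on G). (\<lambda>y. emeasure (\<nu> y) A) \<in> borel_measurable (borel_on X))"

text \<open>For equivalent \<open>x\<close> and \<open>y\<close>, the measures \<open>\<nu> x\<close> and \<open>\<nu> y\<close> are carried by the arrows
  ending in \<open>x\<close> and in \<open>y\<close> respectively; they are compared as measures in the variable \<open>s\<close>,
  that is, through their images under the first projection.\<close>

definition transverse_function ::
  "'a::topological_space set \<Rightarrow> ('a \<times> 'a) set \<Rightarrow> ('a \<Rightarrow> ('a \<times> 'a) measure) \<Rightarrow> bool" where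
  "transverse_function X G \<nu> \<longleftrightarrow>
     kernel X G \<nu> \<and>
     (\<forall>y\<in>X. finite_measure (\<nu> y)) \<and>
     (\<forall>(x, y)\<in>G. distr (\<nu> x) (borel_on X) fst = distr (\<nu> y) (borel_on X) fst)"

definition kernel_scale ::
  "('a \<times> 'a \<Rightarrow> real) \<Rightarrow> ('a \<Rightarrow> ('a \<times> 'a) measure) \<Rightarrow> 'a \<Rightarrow> ('a \<times> 'a) measure" where
  "kernel_scale \<delta> \<kappa> x = density (\<kappa> x) (\<lambda>g. ennreal (\<delta> g))"

text \<open>In the inner integral \<open>h\<close> is an arrow \<open>(s, x)\<close> with \<open>x = fst g\<close>; composing it with
  \<open>g = (x, y)\<close> gives \<open>(s, y)\<close>.\<close>

definition kernel_conv ::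
  "('a::topological_space \<times> 'a) set \<Rightarrow> ('a \<Rightarrow> ('a \<times> 'a) measure) \<Rightarrow>
   ('a \<Rightarrow> ('a \<times> 'a) measure) \<Rightarrow> 'a \<Rightarrow> ('a \<times> 'a) measure" where
  "kernel_conv G \<kappa>1 \<kappa>2 y =
     measure_of G (sets (borel_on G))
       (\<lambda>A. \<integral>\<^sup>+ g. (\<integral>\<^sup>+ h. indicator A (fst h, y) \<partial>\<kappa>2 (fst g)) \<partial>\<kappa>1 y)"

text \<open>Positivity is what makes \<open>\<delta>\<kappa>\<close> a kernel of (positive) measures, and measurability what
  makes the integrals of \<open>\<delta>\<close> meaningful.\<close>

definition modular_function :: "('a::topological_space \<times> 'a) set \<Rightarrow> ('a \<times> 'a \<Rightarrow> real) \<Rightarrow> bool" where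
  "modular_function G \<delta> \<longleftrightarrow>
     \<delta> \<in> borel_measurable (borel_on G) \<and>
     (\<forall>g\<in>G. 0 < \<delta> g) \<and>
     (\<forall>x y z. (x, y) \<in> G \<longrightarrow> (y, z) \<in> G \<longrightarrow> \<delta> (x, z) = \<delta> (x, y) * \<delta> (y, z))"

text \<open>Integrability of \<open>f\<close> means that both sides converge absolutely.\<close>

definition quasi_invariant ::
  "('a::topological_space \<times> 'a) set \<Rightarrow> ('a \<times> 'a \<Rightarrow> real) \<Rightarrow> ('a \<Rightarrow> ('a \<times> 'a) measure) \<Rightarrow>
   'a measure \<Rightarrow> bool" where
  "quasi_invariant G \<delta> \<nu> M \<longleftrightarrow>
     (\<forall>f :: 'a \<times> 'a \<Rightarrow> real.
        f \<in> borel_measurable (borel_on G) \<longrightarrow>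
        (\<integral>\<^sup>+ y. (\<integral>\<^sup>+ g. ennreal \<bar>f (prod.swap g)\<bar> \<partial>\<nu> y) \<partial>M) < \<infinity> \<longrightarrow>
        (\<integral>\<^sup>+ y. (\<integral>\<^sup>+ g. ennreal \<bar>f g * inverse (\<delta> g)\<bar> \<partial>\<nu> y) \<partial>M) < \<infinity> \<longrightarrow>
        (\<integral> y. (\<integral> g. f (prod.swap g) \<partial>\<nu> y) \<partial>M) =
        (\<integral> y. (\<integral> g. f g * inverse (\<delta> g) \<partial>\<nu> y) \<partial>M))"

text \<open>The value \<open>\<infinity>\<close> is admitted, as for measures: a transverse function consists of finite
  measures whose total masses need not be bounded in \<open>y\<close>.  Linearity refers to the cone of
  transverse functions, hence to nonnegative coefficients.\<close>

definition transverse_measure ::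
  "'a::topological_space set \<Rightarrow> ('a \<times> 'a) set \<Rightarrow> ('a \<times> 'a \<Rightarrow> real) \<Rightarrow>
   (('a \<Rightarrow> ('a \<times> 'a) measure) \<Rightarrow> ennreal) \<Rightarrow> bool" where
  "transverse_measure X G \<delta> \<Lambda> \<longleftrightarrow>
     (\<forall>\<nu>1 \<nu>2 \<nu> (a::real) (b::real).
        transverse_function X G \<nu>1 \<longrightarrow> transverse_function X G \<nu>2 \<longrightarrow>
        transverse_function X G \<nu> \<longrightarrow> 0 \<le> a \<longrightarrow> 0 \<le> b \<longrightarrow>
        (\<forall>y\<in>X. \<forall>A \<in> sets (borel_on G).
           emeasure (\<nu> y) A = ennreal a * emeasure (\<nu>1 y) A + ennreal b * emeasure (\<nu>2 y) A) \<longrightarrow>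
        \<Lambda> \<nu> = ennreal a * \<Lambda> \<nu>1 + ennreal b * \<Lambda> \<nu>2) \<and>
     (\<forall>\<kappa> \<nu>1 \<nu>2.
        kernel X G \<kappa> \<longrightarrow> (\<forall>y\<in>X. emeasure (\<kappa> y) G = 1) \<longrightarrow>
        transverse_function X G \<nu>1 \<longrightarrow> transverse_function X G \<nu>2 \<longrightarrow>
        (\<forall>y\<in>X. kernel_conv G \<nu>1 (kernel_scale \<delta> \<kappa>) y = \<nu>2 y) \<longrightarrow>
        \<Lambda> \<nu>1 = \<Lambda> \<nu>2)"

definition factors_through ::
  "'a::topological_space set \<Rightarrow> ('a \<times> 'a) set \<Rightarrow> ('a \<Rightarrow> ('a \<times> 'a) measure) \<Rightarrow>
   ('a \<Rightarrow> ('a \<times> 'a) measure) \<Rightarrow> ('a \<Rightarrow> ('a \<times> 'a) measure) \<Rightarrow> bool" where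
  "factors_through X G \<nu>h \<nu> \<rho> \<longleftrightarrow> kernel X G \<rho> \<and> (\<forall>y\<in>X. \<nu> y = kernel_conv G \<nu>h \<rho> y)"

definition Lambda_val ::
  "('a \<times> 'a \<Rightarrow> real) \<Rightarrow> 'a measure \<Rightarrow> ('a \<Rightarrow> ('a \<times> 'a) measure) \<Rightarrow> ennreal" where
  "Lambda_val \<delta> M \<rho> = (\<integral>\<^sup>+ y. (\<integral>\<^sup>+ g. ennreal (inverse (\<delta> g)) \<partial>\<rho> y) \<partial>M)"

definition Lambda ::
  "'a::topological_space set \<Rightarrow> ('a \<times> 'a) set \<Rightarrow> ('a \<times> 'a \<Rightarrow> real) \<Rightarrow>
   ('a \<Rightarrow> ('a \<times> 'a) measure) \<Rightarrow> 'a measure \<Rightarrow> ('a \<Rightarrow> ('a \<times> 'a) measure) \<Rightarrow> ennreal" where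
  "Lambda X G \<delta> \<nu>h M \<nu> = (THE c. \<exists>\<rho>. factors_through X G \<nu>h \<nu> \<rho> \<and> c = Lambda_val \<delta> M \<rho>)"

end

theory Submission
  imports Defs
begin

text \<open>
  Write \<open>c y\<close> for the total mass of \<open>\<nu>h y\<close>, which is constant on equivalence classes because
  \<open>\<nu>h\<close> is transverse.  The whole theorem rests on one formula that eliminates \<open>\<rho>\<close>: whenever
  \<open>\<nu> = \<nu>h * \<rho>\<close>,
  \<open>\<integral>\<integral> \<delta>(x,y)\<^sup>-\<^sup>1 \<rho>\<^sup>y(dx) dM(y) = \<integral> c(y)\<^sup>-\<^sup>1 (\<integral> \<delta>(s,y)\<^sup>-\<^sup>1 \<nu>\<^sup>y(ds)) dM(y)\<close>
  (lemma \<open>Lambda_val_eq_direct_value\<close>).  To see it, put \<open>h y = \<integral> \<delta>(s,y)\<^sup>-\<^sup>1 \<rho>\<^sup>y(ds)\<close> and use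
  quasi-invariance for the function \<open>(x, y) \<mapsto> h x / c x\<close> on \<open>G\<close>.  On one side the integral against
  \<open>\<nu>h y\<close> only cancels the mass \<open>c y\<close> and leaves \<open>\<integral> h dM\<close>.  On the other side the cocycle
  identity \<open>\<delta>(s,x)\<^sup>-\<^sup>1 \<delta>(x,y)\<^sup>-\<^sup>1 = \<delta>(s,y)\<^sup>-\<^sup>1\<close> turns the integrand into that of the
  convolution \<open>\<nu>h * \<rho> = \<nu>\<close>.

  The right-hand side mentions \<open>\<nu>\<close> only, so \<open>\<Lambda>\<close> does not depend on \<open>\<rho>\<close>, and it is visibly linear.
  A suitable \<open>\<rho>\<close> exists: in the variable \<open>s\<close> the measure \<open>\<nu> x\<close> is the same for all \<open>x\<close> in a
  class, so averaging \<open>\<nu> x / c x\<close> over \<open>\<nu>h y\<close> returns \<open>\<nu> y\<close> (\<open>transverse_factors\<close>).  If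
  \<open>\<nu>2 = \<nu>1 * (\<delta>\<kappa>)\<close> with \<open>\<kappa>\<close> of mass one, the factor \<open>\<delta>(s,x)\<close> cancels the one in
  \<open>\<delta>(s,y)\<^sup>-\<^sup>1 = \<delta>(s,x)\<^sup>-\<^sup>1 \<delta>(x,y)\<^sup>-\<^sup>1\<close> and the mass of \<open>\<kappa>\<close> integrates to one, so the
  right-hand side is the same for both (\<open>direct_value_conv_invariant\<close>).

  Two technical points carry the measure theory.  Quasi-invariance speaks about absolutely
  convergent real integrals, whereas \<open>h\<close> may be infinite; truncation and monotone convergence
  extend it to all nonnegative functions (\<open>quasi_invariant_nn_integral\<close>).  And neither the classes
  nor \<open>G\<close> itself need be Borel, so the integrand \<open>s \<mapsto> \<phi>(s, y)\<close> of a convolution, meaningful only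
  on the class of \<open>y\<close>, is replaced by a section of a Borel function on the whole product that
  extends \<open>\<phi>\<close>.
\<close>

section \<open>Integration against kernels\<close>

lemma kernel_measurable_iff:
  assumes "kernel X G \<kappa>" "y \<in> X"
  shows "\<phi> \<in> measurable (\<kappa> y) N \<longleftrightarrow> \<phi> \<in> measurable (borel_on G) N"
proof -
  have "sets (\<kappa> y) = sets (borel_on G)" using assms by (auto simp: kernel_def)
  then show ?thesis by (simp cong: measurable_cong_sets)
qed

lemma kernel_space:
  assumes "kernel X G \<kappa>" "y \<in> X"
  shows "space (\<kappa> y) = G"
proof -
  have "sets (\<kappa> y) = sets (borel_on G)" using assms by (auto simp: kernel_def)
  from sets_eq_imp_space_eq[OF this] show ?thesis by (simp add: space_restrict_space)
qed

lemma kernel_AE: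
  assumes "kernel X G \<kappa>" "y \<in> X"
  shows "AE g in \<kappa> y. g \<in> G \<and> snd g = y"
proof -
  have "AE g in \<kappa> y. snd g = y" using assms by (auto simp: kernel_def)
  moreover have "AE g in \<kappa> y. g \<in> space (\<kappa> y)" by simp
  ultimately show ?thesis using kernel_space[OF assms] by auto
qed

lemma borel_measurable_kernel_nn_integral:
  assumes "kernel X G \<kappa>" and "\<phi> \<in> borel_measurable (borel_on G)"
  shows "(\<lambda>y. \<integral>\<^sup>+ g. \<phi> g \<partial>\<kappa> y) \<in> borel_measurable (borel_on X)"
  using assms(2)
proof (induction rule: borel_measurable_induct)
  case (cong f g)
  have "(\<integral>\<^sup>+ x. f x \<partial>\<kappa> y) = (\<integral>\<^sup>+ x. g x \<partial>\<kappa> y)" if "y \<in> X" for y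
    using cong(3) kernel_space[OF assms(1) that]
    by (intro nn_integral_cong) (simp add: space_restrict_space)
  then show ?case using cong(4) by (subst measurable_cong) (auto simp: space_restrict_space)
next
  case (set A)
  have "(\<integral>\<^sup>+ x. indicator A x \<partial>\<kappa> y) = emeasure (\<kappa> y) A" if "y \<in> X" for y
    using assms(1) set that by (auto simp: kernel_def)
  moreover have "(\<lambda>y. emeasure (\<kappa> y) A) \<in> borel_measurable (borel_on X)"
    using assms(1) set by (auto simp: kernel_def)
  ultimately show ?case by (subst measurable_cong) (auto simp: space_restrict_space)
next
  case (mult u c)
  have "(\<integral>\<^sup>+ x. c * u x \<partial>\<kappa> y) = c * (\<integral>\<^sup>+ x. u x \<partial>\<kappa> y)" if "y \<in> X" for y
    using mult(2) by (intro nn_integral_cmult) (simp add: kernel_measurable_iff[OF assms(1) that])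
  then show ?case using mult(4)
    by (subst measurable_cong[where g = "\<lambda>y. c * (\<integral>\<^sup>+ x. u x \<partial>\<kappa> y)"])
      (auto simp: space_restrict_space)
next
  case (add u v)
  have "(\<integral>\<^sup>+ x. v x + u x \<partial>\<kappa> y) = (\<integral>\<^sup>+ x. v x \<partial>\<kappa> y) + (\<integral>\<^sup>+ x. u x \<partial>\<kappa> y)" if "y \<in> X" for y
    using add.hyps by (intro nn_integral_add) (simp_all add: kernel_measurable_iff[OF assms(1) that])
  then show ?case using add.IH
    by (subst measurable_cong[where g = "\<lambda>y. (\<integral>\<^sup>+ x. v x \<partial>\<kappa> y) + (\<integral>\<^sup>+ x. u x \<partial>\<kappa> y)"])
      (auto simp: space_restrict_space)
next
  case (seq U)
  have eq: "(SUP i. U i) = (\<lambda>x. SUP i. U i x)" by (auto simp: fun_eq_iff image_image)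
  have "(\<integral>\<^sup>+ x. (SUP i. U i x) \<partial>\<kappa> y) = (SUP i. \<integral>\<^sup>+ x. U i x \<partial>\<kappa> y)" if "y \<in> X" for y
    using seq.hyps
    by (intro nn_integral_monotone_convergence_SUP) (simp_all add: kernel_measurable_iff[OF assms(1) that])
  then show ?case using seq.IH unfolding eq
    by (subst measurable_cong[where g = "\<lambda>y. SUP i. \<integral>\<^sup>+ x. U i x \<partial>\<kappa> y"])
      (auto simp: space_restrict_space)
qed

lemma nn_integral_kernel_monotone_convergence:
  assumes \<kappa>: "kernel X G \<kappa>" and M: "sets M = sets (borel_on X)"
    and mono: "incseq u" and u: "\<And>n. u n \<in> borel_measurable (borel_on G)"
  shows "(\<integral>\<^sup>+ y. (\<integral>\<^sup>+ g. (SUP n. u n g) \<partial>\<kappa> y) \<partial>M) = (SUP n. \<integral>\<^sup>+ y. (\<integral>\<^sup>+ g. u n g \<partial>\<kappa> y) \<partial>M)"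
proof -
  have sp: "space M = X" using sets_eq_imp_space_eq[OF M] by (simp add: space_restrict_space)
  have "(\<integral>\<^sup>+ y. (\<integral>\<^sup>+ g. (SUP n. u n g) \<partial>\<kappa> y) \<partial>M) = (\<integral>\<^sup>+ y. (SUP n. \<integral>\<^sup>+ g. u n g \<partial>\<kappa> y) \<partial>M)"
    using u mono
    by (intro nn_integral_cong nn_integral_monotone_convergence_SUP)
      (simp_all add: kernel_measurable_iff[OF \<kappa>] sp)
  also have "\<dots> = (SUP n. \<integral>\<^sup>+ y. (\<integral>\<^sup>+ g. u n g \<partial>\<kappa> y) \<partial>M)"
  proof (rule nn_integral_monotone_convergence_SUP)
    show "incseq (\<lambda>n y. \<integral>\<^sup>+ g. u n g \<partial>\<kappa> y)"
      using mono by (auto simp: incseq_def le_fun_def intro!: nn_integral_mono)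
    show "(\<lambda>y. \<integral>\<^sup>+ g. u n g \<partial>\<kappa> y) \<in> borel_measurable M" for n
      using borel_measurable_kernel_nn_integral[OF \<kappa> u] M by (simp cong: measurable_cong_sets)
  qed
  finally show ?thesis .
qed

lemma integral_kernel_eq_nn_integral:
  fixes u :: "'a::topological_space \<times> 'a \<Rightarrow> real"
  assumes \<kappa>: "kernel X G \<kappa>" and M: "sets M = sets (borel_on X)"
    and u: "u \<in> borel_measurable (borel_on G)" and pos: "\<And>g. g \<in> G \<Longrightarrow> 0 \<le> u g"
    and fin: "(\<integral>\<^sup>+ y. (\<integral>\<^sup>+ g. ennreal (u g) \<partial>\<kappa> y) \<partial>M) < \<infinity>"
  shows "ennreal (\<integral> y. (\<integral> g. u g \<partial>\<kappa> y) \<partial>M) = (\<integral>\<^sup>+ y. (\<integral>\<^sup>+ g. ennreal (u g) \<partial>\<kappa> y) \<partial>M)"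
proof -
  let ?I = "\<lambda>y. \<integral>\<^sup>+ g. ennreal (u g) \<partial>\<kappa> y"
  have sp: "space M = X" using sets_eq_imp_space_eq[OF M] by (simp add: space_restrict_space)
  have I: "?I \<in> borel_measurable M"
    using borel_measurable_kernel_nn_integral[OF \<kappa>, of "\<lambda>g. ennreal (u g)"] u M
    by (simp cong: measurable_cong_sets)
  have "(\<integral> g. u g \<partial>\<kappa> y) = enn2real (?I y)" if "y \<in> X" for y
    using u pos kernel_space[OF \<kappa> that]
    by (intro integral_eq_nn_integral) (auto simp: kernel_measurable_iff[OF \<kappa> that])
  then have "(\<integral> y. (\<integral> g. u g \<partial>\<kappa> y) \<partial>M) = (\<integral> y. enn2real (?I y) \<partial>M)"
    by (intro Bochner_Integration.integral_cong) (auto simp: sp)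
  also have "\<dots> = enn2real (\<integral>\<^sup>+ y. ennreal (enn2real (?I y)) \<partial>M)"
    using I by (intro integral_eq_nn_integral) auto
  also have "(\<integral>\<^sup>+ y. ennreal (enn2real (?I y)) \<partial>M) = (\<integral>\<^sup>+ y. ?I y \<partial>M)"
  proof (rule nn_integral_cong_AE)
    have "AE y in M. ?I y \<noteq> \<infinity>"
      using I fin by (intro nn_integral_PInf_AE) auto
    then show "AE y in M. ennreal (enn2real (?I y)) = ?I y"
      by eventually_elim (simp add: less_top)
  qed
  finally show ?thesis using fin by simp
qed

section \<open>Convolution of kernels\<close>

text \<open>A Borel set of the subspace is the trace of one of the ambient space, and suprema of extensions
  extend suprema.  The case of interest is \<open>S = G\<close>, which may fail to be Borel in the product.\<close>

lemma borel_measurable_extends: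
  fixes f :: "'b \<Rightarrow> ennreal"
  assumes "f \<in> borel_measurable (restrict_space N S)"
  shows "\<exists>F\<in>borel_measurable N. \<forall>x\<in>S \<inter> space N. F x = f x"
  using assms
proof (induction rule: borel_measurable_induct)
  case (cong f g)
  then show ?case by (auto simp: space_restrict_space)
next
  case (set A)
  then obtain B where "B \<in> sets N" "A = S \<inter> B" by (auto simp: sets_restrict_space)
  then show ?case by (intro bexI[of _ "indicator B"]) (auto simp: indicator_def)
next
  case (mult u c)
  then obtain F where "F \<in> borel_measurable N" "\<forall>x\<in>S \<inter> space N. F x = u x" by blast
  then show ?case by (intro bexI[of _ "\<lambda>x. c * F x"]) auto
next
  case (add u v)
  then obtain F F' where "F \<in> borel_measurable N" "\<forall>x\<in>S \<inter> space N. F x = u x"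
    "F' \<in> borel_measurable N" "\<forall>x\<in>S \<inter> space N. F' x = v x" by blast
  then show ?case by (intro bexI[of _ "\<lambda>x. F' x + F x"]) auto
next
  case (seq U)
  then obtain F where "\<And>i. F i \<in> borel_measurable N" "\<And>i. \<forall>x\<in>S \<inter> space N. F i x = U i x"
    by metis
  then show ?case by (intro bexI[of _ "\<lambda>x. SUP i. F i x"]) (auto simp: image_image)
qed

text \<open>The integral is determined by its values on indicators, additivity, homogeneity and monotone
  convergence.  Both an iterated integral (a convolution) and a linear combination of integrals are
  recognised as integrals against a single measure in this way.\<close>

lemma nn_integral_unique_functional:
  assumes "\<phi> \<in> borel_measurable N"
    and "\<And>f g. (\<And>x. x \<in> space N \<Longrightarrow> f x = g x) \<Longrightarrow> L f = L g"
    and "\<And>A. A \<in> sets N \<Longrightarrow> L (indicator A) = emeasure N A"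
    and "\<And>c u. u \<in> borel_measurable N \<Longrightarrow> L (\<lambda>x. c * u x) = c * L u"
    and "\<And>u v. u \<in> borel_measurable N \<Longrightarrow> v \<in> borel_measurable N \<Longrightarrow>
      L (\<lambda>x. u x + v x) = L u + L v"
    and sup: "\<And>U. (\<And>i::nat. U i \<in> borel_measurable N) \<Longrightarrow> incseq U \<Longrightarrow>
      L (\<lambda>x. SUP i. U i x) = (SUP i. L (U i))"
  shows "L \<phi> = (\<integral>\<^sup>+ x. \<phi> x \<partial>N)"
  using assms(1)
proof (induction rule: borel_measurable_induct)
  case (cong f g)
  have "L f = L g" by (rule assms(2)) (use cong in auto)
  moreover have "(\<integral>\<^sup>+ x. f x \<partial>N) = (\<integral>\<^sup>+ x. g x \<partial>N)" by (rule nn_integral_cong) (use cong in auto)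
  ultimately show ?case using cong by simp
next
  case (set A)
  then show ?case by (simp add: assms(3))
next
  case (mult u c)
  then show ?case by (simp add: assms(4) nn_integral_cmult)
next
  case (add u v)
  then show ?case by (simp add: assms(5) nn_integral_add)
next
  case (seq U)
  have "L (SUP i. U i) = (SUP i. L (U i))" using sup[of U] seq by (simp add: SUP_apply[abs_def] image_image)
  also have "\<dots> = (SUP i. \<integral>\<^sup>+ x. U i x \<partial>N)" using seq by simp
  also have "\<dots> = (\<integral>\<^sup>+ x. (SUP i. U i) x \<partial>N)" unfolding SUP_apply
    using seq by (intro nn_integral_monotone_convergence_SUP[symmetric]) auto
  finally show ?case .
qed

lemma borel_measurable_section:
  fixes F :: "'a::topological_space \<times> 'a \<Rightarrow> ennreal"
  assumes "F \<in> borel_measurable borel"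
  shows "(\<lambda>s. F (s, y)) \<in> borel_measurable borel"
proof -
  have "(\<lambda>s. (s, y)) \<in> borel \<rightarrow>\<^sub>M (borel :: ('a \<times> 'a) measure)"
    by (intro borel_measurable_continuous_onI continuous_intros)
  from measurable_compose[OF this assms] show ?thesis by simp
qed

context
  fixes X :: "'a::topological_space set" and G :: "('a \<times> 'a) set"
  assumes groupoid: "measurable_groupoid X G"
begin

lemma groupoid_equiv: "equiv X G"
  using groupoid by (simp add: measurable_groupoid_def)

lemma groupoid_sym: "(x, y) \<in> G \<Longrightarrow> (y, x) \<in> G"
  using groupoid_equiv by (auto simp: equiv_def sym_def)

lemma groupoid_trans: "(x, y) \<in> G \<Longrightarrow> (y, z) \<in> G \<Longrightarrow> (x, z) \<in> G"
  using groupoid_equiv by (auto simp: equiv_def trans_def)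

lemma groupoid_in_X: "(x, y) \<in> G \<Longrightarrow> x \<in> X \<and> y \<in> X"
  using groupoid_equiv by (auto simp: equiv_def refl_on_def)

lemma fst_measurable: "fst \<in> borel_on G \<rightarrow>\<^sub>M borel_on X"
  using groupoid by (simp add: measurable_groupoid_def)

lemma swap_measurable: "prod.swap \<in> borel_on G \<rightarrow>\<^sub>M borel_on G"
  using groupoid by (simp add: measurable_groupoid_def)

lemma section_measurable:
  assumes "F \<in> borel_measurable (borel :: ('a \<times> 'a) measure)"
  shows "(\<lambda>h. F (fst h, y) :: ennreal) \<in> borel_measurable (borel_on G)"
  by (rule measurable_compose[OF fst_measurable])
    (rule measurable_restrict_space1[OF borel_measurable_section[OF assms]])

lemma conv_inner_measurable:
  assumes "kernel X G \<kappa>2" and "F \<in> borel_measurable (borel :: ('a \<times> 'a) measure)"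
  shows "(\<lambda>g. \<integral>\<^sup>+ h. F (fst h, y) \<partial>\<kappa>2 (fst g)) \<in> borel_measurable (borel_on G)"
  by (rule measurable_compose[OF fst_measurable])
    (rule borel_measurable_kernel_nn_integral[OF assms(1) section_measurable[OF assms(2)]])

text \<open>Almost every pair of arrows \<open>h = (s, x)\<close> and \<open>g = (x, y)\<close> occurring in a convolution is
  composable.\<close>

lemma conv_inner_AE:
  assumes \<kappa>: "kernel X G \<kappa>1" "kernel X G \<kappa>2" and y: "y \<in> X"
  shows "AE g in \<kappa>1 y. (fst g, y) \<in> G \<and> g = (fst g, y) \<and>
    (AE h in \<kappa>2 (fst g). (fst h, fst g) \<in> G \<and> h = (fst h, fst g) \<and> (fst h, y) \<in> G)"
  using kernel_AE[OF \<kappa>(1) y]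
proof eventually_elim
  case (elim g)
  then have g: "(fst g, y) \<in> G" "g = (fst g, y)" by (metis prod.collapse)+
  from kernel_AE[OF \<kappa>(2), of "fst g"] groupoid_in_X[OF g(1)]
  have "AE h in \<kappa>2 (fst g). h \<in> G \<and> snd h = fst g" by simp
  then have "AE h in \<kappa>2 (fst g). (fst h, fst g) \<in> G \<and> h = (fst h, fst g) \<and> (fst h, y) \<in> G"
  proof eventually_elim
    case (elim h)
    then have "(fst h, fst g) \<in> G" "h = (fst h, fst g)" by (metis prod.collapse)+
    then show ?case using groupoid_trans g(1) by blast
  qed
  with g show ?case by blast
qed

text \<open>This is what allows a function on \<open>G\<close> to be exchanged for its extension to the product.\<close>

lemma conv_integral_cong:
  assumes \<kappa>: "kernel X G \<kappa>1" "kernel X G \<kappa>2" and y: "y \<in> X"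
    and eq: "\<And>g. g \<in> G \<Longrightarrow> \<phi> g = (\<psi> g :: ennreal)"
  shows "(\<integral>\<^sup>+ g. (\<integral>\<^sup>+ h. \<phi> (fst h, y) \<partial>\<kappa>2 (fst g)) \<partial>\<kappa>1 y) =
    (\<integral>\<^sup>+ g. (\<integral>\<^sup>+ h. \<psi> (fst h, y) \<partial>\<kappa>2 (fst g)) \<partial>\<kappa>1 y)"
proof (rule nn_integral_cong_AE)
  show "AE g in \<kappa>1 y. (\<integral>\<^sup>+ h. \<phi> (fst h, y) \<partial>\<kappa>2 (fst g)) = (\<integral>\<^sup>+ h. \<psi> (fst h, y) \<partial>\<kappa>2 (fst g))"
    using conv_inner_AE[OF \<kappa> y]
  proof eventually_elim
    case (elim g)
    then show ?case by (intro nn_integral_cong_AE) (auto simp: eq elim: eventually_mono)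
  qed
qed

lemma space_kernel_conv: "space (kernel_conv G \<kappa>1 \<kappa>2 y) = G"
proof -
  have "sets (borel_on G) \<subseteq> Pow G" using sets.space_closed[of "borel_on G"] by (simp add: space_restrict_space)
  then show ?thesis by (simp add: kernel_conv_def space_measure_of)
qed

lemma sets_kernel_conv: "sets (kernel_conv G \<kappa>1 \<kappa>2 y) = sets (borel_on G)"
  using sets.sigma_sets_eq[of "borel_on G"] sets.space_closed[of "borel_on G"]
  by (simp add: kernel_conv_def space_restrict_space)

text \<open>The content here is countable additivity of the set function in the definition of the
  convolution: without it \<^const>\<open>measure_of\<close> would return the zero measure.  The series is
  interchanged with the integrals for Borel traces \<open>B i\<close> of the sets \<open>A i\<close>, since their sections
  are measurable; the \<open>B i\<close> are disjoint only inside \<open>G\<close>, which suffices.\<close>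

lemma emeasure_kernel_conv:
  assumes \<kappa>: "kernel X G \<kappa>1" "kernel X G \<kappa>2" and y: "y \<in> X" and A: "A \<in> sets (borel_on G)"
  shows "emeasure (kernel_conv G \<kappa>1 \<kappa>2 y) A =
    (\<integral>\<^sup>+ g. (\<integral>\<^sup>+ h. indicator A (fst h, y) \<partial>\<kappa>2 (fst g)) \<partial>\<kappa>1 y)"
proof (rule emeasure_measure_of[OF kernel_conv_def])
  let ?L = "\<lambda>A. \<integral>\<^sup>+ g. (\<integral>\<^sup>+ h. indicator A (fst h, y) \<partial>\<kappa>2 (fst g)) \<partial>\<kappa>1 y :: ennreal"
  show "sets (borel_on G) \<subseteq> Pow G"
    using sets.space_closed[of "borel_on G"] by (simp add: space_restrict_space)
  show "A \<in> sets (kernel_conv G \<kappa>1 \<kappa>2 y)" using A by (simp add: sets_kernel_conv)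
  show "positive (sets (kernel_conv G \<kappa>1 \<kappa>2 y)) ?L" by (simp add: positive_def)
  show "countably_additive (sets (kernel_conv G \<kappa>1 \<kappa>2 y)) ?L"
    unfolding sets_kernel_conv
  proof (rule countably_additiveI)
    fix A :: "nat \<Rightarrow> ('a \<times> 'a) set"
    assume A: "range A \<subseteq> sets (borel_on G)" and disj: "disjoint_family A"
    have "\<exists>B\<in>sets borel. A i = G \<inter> B" for i
      using A by (auto simp: sets_restrict_space)
    then obtain B where B: "\<And>i. B i \<in> sets borel" "\<And>i. A i = G \<inter> B i" by metis
    have ind: "(indicator (B i) :: _ \<Rightarrow> ennreal) \<in> borel_measurable borel" for i
      using B(1) by simp
    have "(\<Sum>i. ?L (A i)) = (\<Sum>i. ?L (B i))"
      using B(2) by (intro suminf_cong conv_integral_cong[OF \<kappa> y]) (auto simp: indicator_def)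
    also have "\<dots> = (\<integral>\<^sup>+ g. (\<Sum>i. \<integral>\<^sup>+ h. indicator (B i) (fst h, y) \<partial>\<kappa>2 (fst g)) \<partial>\<kappa>1 y)"
      by (intro nn_integral_suminf[symmetric])
        (simp add: kernel_measurable_iff[OF \<kappa>(1) y] conv_inner_measurable[OF \<kappa>(2) ind])
    also have "\<dots> = (\<integral>\<^sup>+ g. (\<integral>\<^sup>+ h. (\<Sum>i. indicator (B i) (fst h, y)) \<partial>\<kappa>2 (fst g)) \<partial>\<kappa>1 y)"
    proof (rule nn_integral_cong)
      fix g assume "g \<in> space (\<kappa>1 y)"
      then have "fst g \<in> X"
        using kernel_space[OF \<kappa>(1) y] groupoid_in_X[of "fst g" "snd g"] by simp
      then show "(\<Sum>i. \<integral>\<^sup>+ h. indicator (B i) (fst h, y) \<partial>\<kappa>2 (fst g)) =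
          (\<integral>\<^sup>+ h. (\<Sum>i. indicator (B i) (fst h, y)) \<partial>\<kappa>2 (fst g))"
        by (intro nn_integral_suminf[symmetric])
          (simp add: kernel_measurable_iff[OF \<kappa>(2)] section_measurable[OF ind])
    qed
    also have "\<dots> = ?L (\<Union>i. A i)"
    proof (rule conv_integral_cong[OF \<kappa> y, where \<phi> = "\<lambda>g. \<Sum>i. indicator (B i) g"])
      fix g assume "g \<in> G"
      then have "(\<Sum>i. indicator (B i) g) = (\<Sum>i. indicator (A i) g :: ennreal)"
        using B(2) by (intro suminf_cong) (auto simp: indicator_def)
      then show "(\<Sum>i. indicator (B i) g) = (indicator (\<Union>i. A i) g :: ennreal)"
        using suminf_indicator[OF disj] by simp
    qed
    finally show "(\<Sum>i. ?L (A i)) = ?L (\<Union>i. A i)" .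
  qed
qed

lemma nn_integral_kernel_conv:
  assumes \<kappa>: "kernel X G \<kappa>1" "kernel X G \<kappa>2" and y: "y \<in> X"
    and \<phi>: "\<phi> \<in> borel_measurable (borel_on G)"
  shows "(\<integral>\<^sup>+ h. \<phi> h \<partial>kernel_conv G \<kappa>1 \<kappa>2 y) =
    (\<integral>\<^sup>+ g. (\<integral>\<^sup>+ h. \<phi> (fst h, y) \<partial>\<kappa>2 (fst g)) \<partial>\<kappa>1 y)"
proof -
  let ?N = "kernel_conv G \<kappa>1 \<kappa>2 y"
  let ?L = "\<lambda>F. \<integral>\<^sup>+ g. (\<integral>\<^sup>+ h. F (fst h, y) \<partial>\<kappa>2 (fst g)) \<partial>\<kappa>1 y :: ennreal"
  \<comment> \<open>The convolution, seen as a measure on the whole product, where sections of measurable functions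
    are measurable.\<close>
  define N' where "N' = distr ?N borel (\<lambda>x. x)"
  have id: "(\<lambda>x. x) \<in> ?N \<rightarrow>\<^sub>M borel"
    by (subst measurable_cong_sets[OF sets_kernel_conv refl]) (rule measurable_restrict_space1, simp)
  have sets_N': "sets N' = sets borel" by (simp add: N'_def)
  then have meas_N': "measurable N' (borel :: ennreal measure) = measurable borel borel"
    by (simp cong: measurable_cong_sets)
  note inner = section_measurable[of _ y]
  note outer = conv_inner_measurable[OF \<kappa>(2), of _ y]
  have fst_X: "fst g \<in> X" if "g \<in> space (\<kappa>1 y)" for g
    using that kernel_space[OF \<kappa>(1) y] groupoid_in_X[of "fst g" "snd g"] by simp
  obtain F where F: "F \<in> borel_measurable borel" "\<And>g. g \<in> G \<Longrightarrow> F g = \<phi> g"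
    using borel_measurable_extends[OF \<phi>] by auto
  have "(\<integral>\<^sup>+ h. \<phi> h \<partial>?N) = (\<integral>\<^sup>+ h. F h \<partial>?N)"
    using F(2) by (intro nn_integral_cong) (simp add: space_kernel_conv)
  also have "\<dots> = (\<integral>\<^sup>+ h. F h \<partial>N')"
    unfolding N'_def using F(1) by (simp add: nn_integral_distr[OF id])
  also have "\<dots> = ?L F"
  proof (rule nn_integral_unique_functional[symmetric, of F N' ?L])
    show "F \<in> borel_measurable N'" using F(1) by (simp add: meas_N')
    show "?L f = ?L g" if "\<And>x. x \<in> space N' \<Longrightarrow> f x = g x" for f g :: "'a \<times> 'a \<Rightarrow> ennreal"
    proof -
      have "f = g" using that sets_eq_imp_space_eq[OF sets_N'] by auto
      then show ?thesis by simp
    qed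
    show "?L (indicator A) = emeasure N' A" if "A \<in> sets N'" for A
    proof -
      have A: "A \<in> sets borel" using that by (simp add: sets_N')
      have "emeasure N' A = emeasure ?N (G \<inter> A)"
        using emeasure_distr[OF id A] by (simp add: N'_def space_kernel_conv Int_commute)
      also have "\<dots> = ?L (indicator (G \<inter> A))"
        using A by (intro emeasure_kernel_conv[OF \<kappa> y]) (auto simp: sets_restrict_space)
      also have "\<dots> = ?L (indicator A)"
        by (intro conv_integral_cong[OF \<kappa> y]) (auto simp: indicator_def)
      finally show ?thesis by simp
    qed
    show "?L (\<lambda>x. c * u x) = c * ?L u" if "u \<in> borel_measurable N'" for c u
    proof -
      have u: "u \<in> borel_measurable borel" using that by (simp add: meas_N')
      have "?L (\<lambda>x. c * u x) = (\<integral>\<^sup>+ g. c * (\<integral>\<^sup>+ h. u (fst h, y) \<partial>\<kappa>2 (fst g)) \<partial>\<kappa>1 y)"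
        by (intro nn_integral_cong nn_integral_cmult)
          (simp add: kernel_measurable_iff[OF \<kappa>(2)] fst_X inner[OF u])
      also have "\<dots> = c * ?L u"
        by (intro nn_integral_cmult) (simp add: kernel_measurable_iff[OF \<kappa>(1) y] outer[OF u])
      finally show ?thesis .
    qed
    show "?L (\<lambda>x. u x + v x) = ?L u + ?L v"
      if "u \<in> borel_measurable N'" "v \<in> borel_measurable N'" for u v
    proof -
      have u: "u \<in> borel_measurable borel" and v: "v \<in> borel_measurable borel"
        using that by (simp_all add: meas_N')
      have "?L (\<lambda>x. u x + v x) = (\<integral>\<^sup>+ g. (\<integral>\<^sup>+ h. u (fst h, y) \<partial>\<kappa>2 (fst g)) +
          (\<integral>\<^sup>+ h. v (fst h, y) \<partial>\<kappa>2 (fst g)) \<partial>\<kappa>1 y)"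
        by (intro nn_integral_cong nn_integral_add)
          (simp_all add: kernel_measurable_iff[OF \<kappa>(2)] fst_X inner[OF u] inner[OF v])
      also have "\<dots> = ?L u + ?L v"
        by (intro nn_integral_add)
          (simp_all add: kernel_measurable_iff[OF \<kappa>(1) y] outer[OF u] outer[OF v])
      finally show ?thesis .
    qed
    show "?L (\<lambda>x. SUP i. U i x) = (SUP i. ?L (U i))"
      if "\<And>i::nat. U i \<in> borel_measurable N'" and mono: "incseq U" for U
    proof -
      have U: "U i \<in> borel_measurable borel" for i using that(1)[of i] by (simp add: meas_N')
      have "?L (\<lambda>x. SUP i. U i x) =
          (\<integral>\<^sup>+ g. (SUP i. \<integral>\<^sup>+ h. U i (fst h, y) \<partial>\<kappa>2 (fst g)) \<partial>\<kappa>1 y)"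
        using mono
        by (intro nn_integral_cong nn_integral_monotone_convergence_SUP)
          (auto simp: kernel_measurable_iff[OF \<kappa>(2)] fst_X inner[OF U] incseq_def le_fun_def)
      also have "\<dots> = (SUP i. ?L (U i))"
        using mono
        by (intro nn_integral_monotone_convergence_SUP)
          (auto simp: kernel_measurable_iff[OF \<kappa>(1) y] outer[OF U] incseq_def le_fun_def
            intro!: nn_integral_mono)
      finally show ?thesis .
    qed
  qed
  also have "\<dots> = ?L \<phi>" by (rule conv_integral_cong[OF \<kappa> y F(2)])
  finally show ?thesis .
qed

section \<open>Transverse functions\<close>

lemma transverse_kernel: "transverse_function X G \<nu> \<Longrightarrow> kernel X G \<nu>"
  by (simp add: transverse_function_def)

text \<open>Invariance of a transverse function, stated for arrows: moving the endpoint from \<open>x\<close> to \<open>y\<close>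
  does not change the integral, since only the first coordinates of the arrows matter.\<close>

lemma transverse_nn_integral:
  assumes \<nu>: "transverse_function X G \<nu>" and xy: "(x, y) \<in> G"
    and \<phi>: "\<phi> \<in> borel_measurable (borel_on G)"
  shows "(\<integral>\<^sup>+ h. \<phi> (fst h, y) \<partial>\<nu> x) = (\<integral>\<^sup>+ h. \<phi> h \<partial>\<nu> y)"
proof -
  note \<kappa> = transverse_kernel[OF \<nu>]
  have X: "x \<in> X" "y \<in> X" using groupoid_in_X[OF xy] by auto
  obtain F where F: "F \<in> borel_measurable borel" "\<And>g. g \<in> G \<Longrightarrow> F g = \<phi> g"
    using borel_measurable_extends[OF \<phi>] by auto
  have fst': "fst \<in> \<nu> z \<rightarrow>\<^sub>M borel_on X" if "z \<in> X" for z
    using fst_measurable by (simp add: kernel_measurable_iff[OF \<kappa> that])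
  have sec: "(\<lambda>s. F (s, y)) \<in> borel_measurable (borel_on X)"
    by (rule measurable_restrict_space1[OF borel_measurable_section[OF F(1)]])
  have "(\<integral>\<^sup>+ h. \<phi> (fst h, y) \<partial>\<nu> x) = (\<integral>\<^sup>+ h. F (fst h, y) \<partial>\<nu> x)"
  proof (rule nn_integral_cong_AE)
    show "AE h in \<nu> x. \<phi> (fst h, y) = F (fst h, y)"
      using kernel_AE[OF \<kappa> X(1)]
    proof eventually_elim
      case (elim h)
      then have "(fst h, x) \<in> G" by (metis prod.collapse)
      then show ?case using groupoid_trans[OF _ xy] F(2) by simp
    qed
  qed
  also have "\<dots> = (\<integral>\<^sup>+ s. F (s, y) \<partial>distr (\<nu> x) (borel_on X) fst)"
    using sec by (simp add: nn_integral_distr[OF fst'[OF X(1)]])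
  also have "distr (\<nu> x) (borel_on X) fst = distr (\<nu> y) (borel_on X) fst"
    using \<nu> xy by (auto simp: transverse_function_def)
  also have "(\<integral>\<^sup>+ s. F (s, y) \<partial>distr (\<nu> y) (borel_on X) fst) = (\<integral>\<^sup>+ h. F (fst h, y) \<partial>\<nu> y)"
    using sec by (simp add: nn_integral_distr[OF fst'[OF X(2)]])
  also have "\<dots> = (\<integral>\<^sup>+ h. \<phi> h \<partial>\<nu> y)"
  proof (rule nn_integral_cong_AE)
    show "AE h in \<nu> y. F (fst h, y) = \<phi> h"
      using kernel_AE[OF \<kappa> X(2)] by eventually_elim (auto simp: F(2))
  qed
  finally show ?thesis .
qed

lemma transverse_mass_eq:
  assumes "transverse_function X G \<nu>" and "(x, y) \<in> G"
  shows "emeasure (\<nu> x) G = emeasure (\<nu> y) G"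
proof -
  have X: "x \<in> X" "y \<in> X" using groupoid_in_X[OF assms(2)] by auto
  show ?thesis
    using transverse_nn_integral[OF assms, of "\<lambda>_. 1"]
      kernel_space[OF transverse_kernel[OF assms(1)]] X by (metis borel_measurable_const
      mult.left_neutral nn_integral_const)
qed

lemma transverse_mass_finite:
  assumes "transverse_function X G \<nu>" and "y \<in> X"
  shows "emeasure (\<nu> y) G < \<infinity>"
proof -
  interpret finite_measure "\<nu> y" using assms by (simp add: transverse_function_def)
  show ?thesis using emeasure_finite[of G] top.not_eq_extremum by (metis infinity_ennreal_def)
qed

lemma kernel_mass_measurable:
  assumes "kernel X G \<kappa>"
  shows "(\<lambda>y. emeasure (\<kappa> y) G) \<in> borel_measurable (borel_on X)"
  using assms sets.top[of "borel_on G"] by (simp add: kernel_def space_restrict_space)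

lemma nn_integral_inverse_mass:
  assumes \<nu>h: "transverse_function X G \<nu>h" and pos: "emeasure (\<nu>h y) G \<noteq> 0" and y: "y \<in> X"
  shows "(\<integral>\<^sup>+ g. c * inverse (emeasure (\<nu>h y) G) \<partial>\<nu>h y) = c"
proof -
  have "inverse (emeasure (\<nu>h y) G) * emeasure (\<nu>h y) G = 1"
    using transverse_mass_finite[OF \<nu>h y] pos
    by (metis divide_ennreal_def ennreal_divide_self infinity_ennreal_def mult.commute)
  then show ?thesis by (simp add: kernel_space[OF transverse_kernel[OF \<nu>h] y] mult.assoc)
qed

text \<open>After dividing by the mass, every \<open>\<rho> x\<close> with \<open>x\<close> in the class of \<open>y\<close> is the same measure
  \<open>\<nu> y / c y\<close> in the variable \<open>s\<close>, and integrating this constant against \<open>\<nu>h y\<close> restores \<open>\<nu> y\<close>.\<close>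

lemma transverse_factors:
  assumes \<nu>h: "transverse_function X G \<nu>h" and pos: "\<forall>y\<in>X. emeasure (\<nu>h y) G \<noteq> 0"
    and \<nu>: "transverse_function X G \<nu>"
  shows "factors_through X G \<nu>h \<nu> (\<lambda>x. scale_measure (inverse (emeasure (\<nu>h x) G)) (\<nu> x))"
    (is "factors_through X G \<nu>h \<nu> ?\<rho>")
  unfolding factors_through_def
proof (intro conjI ballI)
  note k = transverse_kernel[OF \<nu>h] transverse_kernel[OF \<nu>]
  show \<rho>: "kernel X G ?\<rho>"
    unfolding kernel_def
  proof (intro conjI ballI)
    fix y assume y: "y \<in> X"
    show "sets (?\<rho> y) = sets (borel_on G)" using k(2) y by (simp add: kernel_def)
    have "\<exists>N\<in>null_sets (\<nu> y). {g \<in> space (\<nu> y). snd g \<noteq> y} \<subseteq> N"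
      using k(2) y by (auto simp: kernel_def eventually_ae_filter)
    then show "AE g in ?\<rho> y. snd g = y"
      by (auto simp: eventually_ae_filter null_sets_def space_scale_measure)
  next
    fix A assume "A \<in> sets (borel_on G)"
    then have "(\<lambda>y. emeasure (\<nu> y) A) \<in> borel_measurable (borel_on X)"
      using k(2) by (simp add: kernel_def)
    then show "(\<lambda>y. emeasure (?\<rho> y) A) \<in> borel_measurable (borel_on X)"
      using kernel_mass_measurable[OF k(1)] by simp
  qed
  fix y assume y: "y \<in> X"
  let ?c = "emeasure (\<nu>h y) G"
  show "\<nu> y = kernel_conv G \<nu>h ?\<rho> y"
  proof (rule measure_eqI)
    show sets: "sets (\<nu> y) = sets (kernel_conv G \<nu>h ?\<rho> y)"
      using k(2) y by (simp add: sets_kernel_conv kernel_def)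
    fix A assume "A \<in> sets (\<nu> y)"
    then have A: "A \<in> sets (borel_on G)" using sets by (simp add: sets_kernel_conv)
    have meas: "(indicator A :: _ \<Rightarrow> ennreal) \<in> borel_measurable (borel_on G)" using A by simp
    obtain F :: "_ \<Rightarrow> ennreal" where F: "F \<in> borel_measurable borel" "\<And>g. g \<in> G \<Longrightarrow> F g = indicator A g"
      using borel_measurable_extends[OF meas] by auto
    have "emeasure (kernel_conv G \<nu>h ?\<rho> y) A =
        (\<integral>\<^sup>+ g. (\<integral>\<^sup>+ h. F (fst h, y) \<partial>?\<rho> (fst g)) \<partial>\<nu>h y)"
      unfolding emeasure_kernel_conv[OF k(1) \<rho> y A]
      by (rule conv_integral_cong[OF k(1) \<rho> y]) (simp add: F(2))
    also have "\<dots> = (\<integral>\<^sup>+ g. inverse ?c * emeasure (\<nu> y) A \<partial>\<nu>h y)"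
    proof (rule nn_integral_cong_AE)
      show "AE g in \<nu>h y. (\<integral>\<^sup>+ h. F (fst h, y) \<partial>?\<rho> (fst g)) = inverse ?c * emeasure (\<nu> y) A"
        using kernel_AE[OF k(1) y]
      proof eventually_elim
        case (elim g)
        then have g: "(fst g, y) \<in> G" by (metis prod.collapse)
        then have x: "fst g \<in> X" using groupoid_in_X by blast
        have FG: "F \<in> borel_measurable (borel_on G)" by (rule measurable_restrict_space1[OF F(1)])
        have "(\<integral>\<^sup>+ h. F (fst h, y) \<partial>?\<rho> (fst g)) =
            inverse (emeasure (\<nu>h (fst g)) G) * (\<integral>\<^sup>+ h. F (fst h, y) \<partial>\<nu> (fst g))"
          by (intro nn_integral_scale_measure)
            (simp add: kernel_measurable_iff[OF k(2) x] section_measurable[OF F(1)])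
        also have "\<dots> = inverse ?c * (\<integral>\<^sup>+ h. F h \<partial>\<nu> y)"
          by (simp add: transverse_nn_integral[OF \<nu> g FG] transverse_mass_eq[OF \<nu>h g])
        also have "(\<integral>\<^sup>+ h. F h \<partial>\<nu> y) = (\<integral>\<^sup>+ h. indicator A h \<partial>\<nu> y)"
          using F(2) kernel_space[OF k(2) y] by (intro nn_integral_cong) simp
        also have "\<dots> = emeasure (\<nu> y) A" using A sets by (simp add: sets_kernel_conv)
        finally show ?case .
      qed
    qed
    also have "\<dots> = emeasure (\<nu> y) A"
      using nn_integral_inverse_mass[OF \<nu>h _ y] pos y by (simp add: mult.commute)
    finally show "emeasure (\<nu> y) A = emeasure (kernel_conv G \<nu>h ?\<rho> y) A" by simp
  qed
qed

section \<open>Quasi-invariance for nonnegative functions\<close>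

lemma modular_inverse_measurable:
  assumes "modular_function G \<delta>"
  shows "(\<lambda>g. ennreal (inverse (\<delta> g))) \<in> borel_measurable (borel_on G)"
  using assms by (auto simp: modular_function_def)

text \<open>A nonnegative \<open>f\<close> is the increasing limit of its truncations \<open>min f n\<close> to the sets \<open>S n\<close> where the
  mass \<open>c\<close> and \<open>\<delta>\<^sup>-\<^sup>1\<close> are at most \<open>n\<close>.  The bound on the mass is invariant along classes, hence
  the same at both ends of an arrow; together the bounds make both sides of the quasi-invariance
  relation finite for the truncated function.\<close>

lemma quasi_invariant_nn_integral:
  assumes \<delta>: "modular_function G \<delta>" and \<nu>: "transverse_function X G \<nu>"
    and M: "prob_space M" "sets M = sets (borel_on X)"
    and qi: "quasi_invariant G \<delta> \<nu> M"
    and f: "f \<in> borel_measurable (borel_on G)"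
  shows "(\<integral>\<^sup>+ y. (\<integral>\<^sup>+ g. f (prod.swap g) \<partial>\<nu> y) \<partial>M) =
    (\<integral>\<^sup>+ y. (\<integral>\<^sup>+ g. f g * ennreal (inverse (\<delta> g)) \<partial>\<nu> y) \<partial>M)"
proof -
  interpret M: prob_space M by fact
  note \<kappa> = transverse_kernel[OF \<nu>]
  have sp: "space M = X" using sets_eq_imp_space_eq[OF M(2)] by (simp add: space_restrict_space)
  have \<delta>m: "\<delta> \<in> borel_measurable (borel_on G)" and \<delta>pos: "\<And>g. g \<in> G \<Longrightarrow> 0 < \<delta> g"
    using \<delta> by (auto simp: modular_function_def)
  define c where "c g = emeasure (\<nu> (fst g)) G" for g :: "'a \<times> 'a"
  have cm: "c \<in> borel_measurable (borel_on G)"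
    unfolding c_def by (rule measurable_compose[OF fst_measurable kernel_mass_measurable[OF \<kappa>]])
  define S where "S n = {g \<in> G. c g \<le> of_nat n \<and> inverse (\<delta> g) \<le> real n}" for n :: nat
  have Sm: "S n \<in> sets (borel_on G)" for n
  proof -
    have "{g \<in> space (borel_on G). c g \<le> of_nat n \<and> inverse (\<delta> g) \<le> real n} \<in> sets (borel_on G)"
      using cm \<delta>m by measurable
    then show ?thesis by (simp add: S_def space_restrict_space)
  qed
  \<comment> \<open>The truncation twice: real-valued as quasi-invariance wants it, and extended as the limit wants it.\<close>
  define r where "r n g = enn2real (min (f g) (of_nat n)) * indicator (S n) g" for n g
  define t where "t n g = min (f g) (of_nat n) * indicator (S n) g" for n g
  have rm: "r n \<in> borel_measurable (borel_on G)" for n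
    unfolding r_def using f Sm by measurable
  have tm: "t n \<in> borel_measurable (borel_on G)" for n
    unfolding t_def using f Sm by measurable
  have r_nonneg: "0 \<le> r n g" for n g by (simp add: r_def)
  have rt: "ennreal (r n g) = t n g" for n g
  proof -
    have "min (f g) (of_nat n) < top"
      by (metis min.strict_coboundedI2 of_nat_less_top)
    then show ?thesis by (auto simp: r_def t_def indicator_def)
  qed
  have inc_t: "incseq t"
  proof (intro incseq_SucI le_funI)
    fix n g
    have "S n \<subseteq> S (Suc n)" by (auto simp: S_def intro: order_trans)
    then show "t n g \<le> t (Suc n) g"
      unfolding t_def by (intro mult_mono min.mono) (auto simp: indicator_def)
  qed
  have sup_t: "(SUP n. t n g) = f g" if g: "g \<in> G" for g
  proof (rule antisym)
    show "(SUP n. t n g) \<le> f g"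
      by (intro SUP_least) (auto simp: t_def indicator_def)
    show "f g \<le> (SUP n. t n g)"
      unfolding le_SUP_iff
    proof (intro allI impI)
      fix z assume z: "z < f g"
      have "c g < top"
        using transverse_mass_finite[OF \<nu>] groupoid_in_X[of "fst g" "snd g"] g by (simp add: c_def)
      then obtain n1 n2 n3 :: nat where n: "c g < of_nat n1" "z < of_nat n2" "inverse (\<delta> g) < real n3"
        using z by (metis ennreal_Ex_less_of_nat less_le_trans top_greatest reals_Archimedean2)
      define n where "n = max n1 (max n2 n3)"
      have "c g \<le> of_nat n" "inverse (\<delta> g) \<le> real n" "z < of_nat n"
        using n by (auto simp: n_def less_max_iff_disj le_max_iff_disj of_nat_max max_def
          intro: order.trans order.strict_trans2 dest: less_imp_le)
      then have "z < t n g" using z g by (simp add: t_def S_def)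
      then show "\<exists>n\<in>UNIV. z < t n g" by blast
    qed
  qed
  have mass: "AE g in \<nu> y. g \<in> G \<and> c g = emeasure (\<nu> y) G \<and> c (prod.swap g) = emeasure (\<nu> y) G"
    if "y \<in> X" for y
    using kernel_AE[OF \<kappa> that]
  proof eventually_elim
    case (elim g)
    then have "(fst g, y) \<in> G" by (metis prod.collapse)
    then show ?case using elim transverse_mass_eq[OF \<nu>] by (simp add: c_def)
  qed
  have t_le: "t n g \<le> of_nat n" for n g by (simp add: t_def indicator_def)
  have t_0: "t n g = 0" if "\<not> c g \<le> of_nat n \<or> \<not> inverse (\<delta> g) \<le> real n" for n g
    using that by (auto simp: t_def indicator_def S_def)
  have inner_le: "(\<integral>\<^sup>+ g. v g \<partial>\<nu> y) \<le> b * of_nat n"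
    if y: "y \<in> X" and v: "AE g in \<nu> y. v g \<le> b"
      and v0: "AE g in \<nu> y. \<not> emeasure (\<nu> y) G \<le> of_nat n \<longrightarrow> v g = 0"
    for v y and n :: nat and b :: ennreal
  proof (cases "emeasure (\<nu> y) G \<le> of_nat n")
    case True
    have "(\<integral>\<^sup>+ g. v g \<partial>\<nu> y) \<le> (\<integral>\<^sup>+ g. b \<partial>\<nu> y)" by (rule nn_integral_mono_AE[OF v])
    also have "\<dots> = b * emeasure (\<nu> y) G" by (simp add: kernel_space[OF \<kappa> y])
    also have "\<dots> \<le> b * of_nat n" using True by (rule mult_left_mono) simp
    finally show ?thesis .
  next
    case False
    have "(\<integral>\<^sup>+ g. v g \<partial>\<nu> y) = (\<integral>\<^sup>+ g. 0 \<partial>\<nu> y)"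
      by (rule nn_integral_cong_AE) (use v0 False in simp)
    then show ?thesis by simp
  qed
  have outer_fin: "(\<integral>\<^sup>+ y. w y \<partial>M) < \<infinity>"
    if "\<And>y. y \<in> X \<Longrightarrow> w y \<le> b" "b < \<infinity>" for w :: "'a \<Rightarrow> ennreal" and b
  proof -
    have "(\<integral>\<^sup>+ y. w y \<partial>M) \<le> (\<integral>\<^sup>+ y. b \<partial>M)" using that(1) by (intro nn_integral_mono) (simp add: sp)
    also have "\<dots> = b" by (simp add: M.emeasure_space_1)
    finally show ?thesis using that(2) by simp
  qed
  have left_fin: "(\<integral>\<^sup>+ y. (\<integral>\<^sup>+ g. t n (prod.swap g) \<partial>\<nu> y) \<partial>M) < \<infinity>" for n
  proof (rule outer_fin[of _ "of_nat n * of_nat n"])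
    fix y assume y: "y \<in> X"
    show "(\<integral>\<^sup>+ g. t n (prod.swap g) \<partial>\<nu> y) \<le> of_nat n * of_nat n"
    proof (rule inner_le[OF y])
      show "AE g in \<nu> y. t n (prod.swap g) \<le> of_nat n" by (simp add: t_le)
      show "AE g in \<nu> y. \<not> emeasure (\<nu> y) G \<le> of_nat n \<longrightarrow> t n (prod.swap g) = 0"
        using mass[OF y] by eventually_elim (metis t_0)
    qed
  qed (simp add: ennreal_mult_less_top of_nat_less_top)
  have t_inv_le: "t n g * ennreal (inverse (\<delta> g)) \<le> of_nat n * of_nat n" for n g
  proof (cases "inverse (\<delta> g) \<le> real n")
    case True
    then have "ennreal (inverse (\<delta> g)) \<le> of_nat n"
      by (simp add: ennreal_of_nat_eq_real_of_nat ennreal_leI)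
    then show ?thesis using t_le by (intro mult_mono) auto
  qed (simp add: t_0)
  have right_fin: "(\<integral>\<^sup>+ y. (\<integral>\<^sup>+ g. t n g * ennreal (inverse (\<delta> g)) \<partial>\<nu> y) \<partial>M) < \<infinity>" for n
  proof (rule outer_fin[of _ "of_nat n * of_nat n * of_nat n"])
    fix y assume y: "y \<in> X"
    show "(\<integral>\<^sup>+ g. t n g * ennreal (inverse (\<delta> g)) \<partial>\<nu> y) \<le> of_nat n * of_nat n * of_nat n"
    proof (rule inner_le[OF y])
      show "AE g in \<nu> y. t n g * ennreal (inverse (\<delta> g)) \<le> of_nat n * of_nat n"
        by (simp add: t_inv_le)
      show "AE g in \<nu> y. \<not> emeasure (\<nu> y) G \<le> of_nat n \<longrightarrow> t n g * ennreal (inverse (\<delta> g)) = 0"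
        using mass[OF y] by eventually_elim (metis t_0 mult_zero_left)
    qed
  qed (simp add: ennreal_mult_less_top of_nat_less_top)
  have swap_in: "prod.swap g \<in> G" if "g \<in> G" for g
    using that groupoid_sym[of "fst g" "snd g"] by (cases g) auto
  have abs_left: "ennreal \<bar>r n (prod.swap g)\<bar> = t n (prod.swap g)" for n g
    by (simp add: rt[symmetric] r_nonneg)
  have abs_right: "ennreal \<bar>r n g * inverse (\<delta> g)\<bar> = t n g * ennreal (inverse (\<delta> g))"
    if "g \<in> G" for n g
    using r_nonneg[of n g] \<delta>pos[OF that] by (simp add: rt[symmetric] ennreal_mult abs_mult)
  have inner_right: "(\<integral>\<^sup>+ g. ennreal \<bar>r n g * inverse (\<delta> g)\<bar> \<partial>\<nu> y) =
      (\<integral>\<^sup>+ g. t n g * ennreal (inverse (\<delta> g)) \<partial>\<nu> y)" if "y \<in> space M" for n y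
    using that kernel_space[OF \<kappa>, of y] by (intro nn_integral_cong abs_right) (simp add: sp)
  have truncated: "(\<integral>\<^sup>+ y. (\<integral>\<^sup>+ g. t n (prod.swap g) \<partial>\<nu> y) \<partial>M) =
      (\<integral>\<^sup>+ y. (\<integral>\<^sup>+ g. t n g * ennreal (inverse (\<delta> g)) \<partial>\<nu> y) \<partial>M)" for n
  proof -
    have R: "(\<integral>\<^sup>+ y. (\<integral>\<^sup>+ g. ennreal \<bar>r n g * inverse (\<delta> g)\<bar> \<partial>\<nu> y) \<partial>M) =
        (\<integral>\<^sup>+ y. (\<integral>\<^sup>+ g. t n g * ennreal (inverse (\<delta> g)) \<partial>\<nu> y) \<partial>M)"
      by (rule nn_integral_cong) (rule inner_right)
    have R': "(\<integral>\<^sup>+ y. (\<integral>\<^sup>+ g. ennreal (r n g * inverse (\<delta> g)) \<partial>\<nu> y) \<partial>M) =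
        (\<integral>\<^sup>+ y. (\<integral>\<^sup>+ g. ennreal \<bar>r n g * inverse (\<delta> g)\<bar> \<partial>\<nu> y) \<partial>M)"
      using r_nonneg \<delta>pos
      by (intro nn_integral_cong) (simp add: sp kernel_space[OF \<kappa>] abs_mult less_imp_le)
    have eq: "(\<integral> y. (\<integral> g. r n (prod.swap g) \<partial>\<nu> y) \<partial>M) = (\<integral> y. (\<integral> g. r n g * inverse (\<delta> g) \<partial>\<nu> y) \<partial>M)"
      using qi rm[of n] left_fin[of n] right_fin[of n] unfolding quasi_invariant_def
      by (simp only: abs_left R)
    have "(\<integral>\<^sup>+ y. (\<integral>\<^sup>+ g. t n (prod.swap g) \<partial>\<nu> y) \<partial>M) = ennreal (\<integral> y. (\<integral> g. r n (prod.swap g) \<partial>\<nu> y) \<partial>M)"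
      using integral_kernel_eq_nn_integral[OF \<kappa> M(2), of "\<lambda>g. r n (prod.swap g)"]
        measurable_compose[OF swap_measurable rm] r_nonneg left_fin by (simp add: rt)
    also have "\<dots> = (\<integral>\<^sup>+ y. (\<integral>\<^sup>+ g. ennreal (r n g * inverse (\<delta> g)) \<partial>\<nu> y) \<partial>M)"
      unfolding eq
    proof (rule integral_kernel_eq_nn_integral[OF \<kappa> M(2)])
      show "(\<lambda>g. r n g * inverse (\<delta> g)) \<in> borel_measurable (borel_on G)"
        using rm \<delta>m by measurable
      show "0 \<le> r n g * inverse (\<delta> g)" if "g \<in> G" for g
        using r_nonneg[of n g] \<delta>pos[OF that] by simp
      show "(\<integral>\<^sup>+ y. (\<integral>\<^sup>+ g. ennreal (r n g * inverse (\<delta> g)) \<partial>\<nu> y) \<partial>M) < \<infinity>"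
        unfolding R' R by (rule right_fin)
    qed
    also have "\<dots> = (\<integral>\<^sup>+ y. (\<integral>\<^sup>+ g. t n g * ennreal (inverse (\<delta> g)) \<partial>\<nu> y) \<partial>M)"
      unfolding R' R ..
    finally show ?thesis .
  qed
  have "(\<integral>\<^sup>+ y. (\<integral>\<^sup>+ g. f (prod.swap g) \<partial>\<nu> y) \<partial>M) =
      (\<integral>\<^sup>+ y. (\<integral>\<^sup>+ g. (SUP n. t n (prod.swap g)) \<partial>\<nu> y) \<partial>M)"
    by (intro nn_integral_cong) (simp add: sp kernel_space[OF \<kappa>] sup_t swap_in)
  also have "\<dots> = (SUP n. \<integral>\<^sup>+ y. (\<integral>\<^sup>+ g. t n (prod.swap g) \<partial>\<nu> y) \<partial>M)"
    using inc_t measurable_compose[OF swap_measurable tm]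
    by (intro nn_integral_kernel_monotone_convergence[OF \<kappa> M(2)]) (auto simp: incseq_def le_fun_def)
  also have "\<dots> = (SUP n. \<integral>\<^sup>+ y. (\<integral>\<^sup>+ g. t n g * ennreal (inverse (\<delta> g)) \<partial>\<nu> y) \<partial>M)"
    by (simp only: truncated)
  also have "\<dots> = (\<integral>\<^sup>+ y. (\<integral>\<^sup>+ g. (SUP n. t n g * ennreal (inverse (\<delta> g))) \<partial>\<nu> y) \<partial>M)"
    using inc_t borel_measurable_times_ennreal[OF tm modular_inverse_measurable[OF \<delta>]]
    by (intro nn_integral_kernel_monotone_convergence[OF \<kappa> M(2), symmetric])
      (auto simp: incseq_def le_fun_def intro: mult_right_mono)
  also have "\<dots> = (\<integral>\<^sup>+ y. (\<integral>\<^sup>+ g. f g * ennreal (inverse (\<delta> g)) \<partial>\<nu> y) \<partial>M)"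
    by (intro nn_integral_cong) (simp add: sp kernel_space[OF \<kappa>] sup_t SUP_mult_right_ennreal[symmetric])
  finally show ?thesis .
qed

section \<open>The transverse measure\<close>

text \<open>The value of \<open>\<Lambda>\<close> on \<open>\<nu>\<close>, expressed without a factorisation.\<close>

definition direct_value ::
  "('a \<times> 'a \<Rightarrow> real) \<Rightarrow> ('a \<Rightarrow> ('a \<times> 'a) measure) \<Rightarrow> 'a measure \<Rightarrow>
   ('a \<Rightarrow> ('a \<times> 'a) measure) \<Rightarrow> ennreal" where
  "direct_value \<delta> \<nu>h M \<nu> =
     (\<integral>\<^sup>+ y. inverse (emeasure (\<nu>h y) G) * (\<integral>\<^sup>+ g. ennreal (inverse (\<delta> g)) \<partial>\<nu> y) \<partial>M)"

lemma modular_inverse_mult: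
  assumes "modular_function G \<delta>" "(s, x) \<in> G" "(x, y) \<in> G"
  shows "ennreal (inverse (\<delta> (s, y))) = ennreal (inverse (\<delta> (s, x))) * ennreal (inverse (\<delta> (x, y)))"
proof -
  have "\<delta> (s, y) = \<delta> (s, x) * \<delta> (x, y)" "0 < \<delta> (s, x)" "0 < \<delta> (x, y)"
    using assms unfolding modular_function_def by blast+
  then show ?thesis by (simp add: ennreal_mult)
qed

text \<open>Quasi-invariance is used for \<open>f = (\<lambda>(x, y). h x / c x)\<close>.  Composed with the swap, \<open>f\<close> is the
  constant \<open>h y / c y\<close> for \<open>\<nu>h y\<close> and integrates to \<open>h y\<close>; weighted with \<open>\<delta>\<^sup>-\<^sup>1\<close>, it becomes the
  inner integral of the convolution \<open>\<nu>h * \<rho>\<close>, up to \<open>1 / c x = 1 / c y\<close>.\<close>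

lemma Lambda_val_eq_direct_value:
  assumes \<delta>: "modular_function G \<delta>" and \<nu>h: "transverse_function X G \<nu>h"
    and pos: "\<forall>y\<in>X. emeasure (\<nu>h y) G \<noteq> 0"
    and M: "prob_space M" "sets M = sets (borel_on X)"
    and qi: "quasi_invariant G \<delta> \<nu>h M"
    and fac: "factors_through X G \<nu>h \<nu> \<rho>"
  shows "Lambda_val \<delta> M \<rho> = direct_value \<delta> \<nu>h M \<nu>"
proof -
  have \<rho>: "kernel X G \<rho>" and conv: "\<And>y. y \<in> X \<Longrightarrow> \<nu> y = kernel_conv G \<nu>h \<rho> y"
    using fac by (auto simp: factors_through_def)
  note k = transverse_kernel[OF \<nu>h]
  have sp: "space M = X" using sets_eq_imp_space_eq[OF M(2)] by (simp add: space_restrict_space)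
  let ?d = "\<lambda>g. ennreal (inverse (\<delta> g))"
  note dm = modular_inverse_measurable[OF \<delta>]
  define c where "c y = emeasure (\<nu>h y) G" for y
  define h where "h y = (\<integral>\<^sup>+ g. ?d g \<partial>\<rho> y)" for y
  define f where "f g = h (fst g) * inverse (c (fst g))" for g :: "'a \<times> 'a"
  have "(\<lambda>y. h y * inverse (c y)) \<in> borel_measurable (borel_on X)"
    unfolding h_def c_def
    using borel_measurable_kernel_nn_integral[OF \<rho> dm] kernel_mass_measurable[OF k] by measurable
  then have fm: "f \<in> borel_measurable (borel_on G)"
    unfolding f_def by (rule measurable_compose[OF fst_measurable])
  have "Lambda_val \<delta> M \<rho> = (\<integral>\<^sup>+ y. h y \<partial>M)" by (simp add: Lambda_val_def h_def)
  also have "\<dots> = (\<integral>\<^sup>+ y. (\<integral>\<^sup>+ g. f (prod.swap g) \<partial>\<nu>h y) \<partial>M)"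
  proof (rule nn_integral_cong)
    fix y assume "y \<in> space M"
    then have y: "y \<in> X" by (simp add: sp)
    have "(\<integral>\<^sup>+ g. f (prod.swap g) \<partial>\<nu>h y) = (\<integral>\<^sup>+ g. h y * inverse (c y) \<partial>\<nu>h y)"
      using kernel_AE[OF k y] by (intro nn_integral_cong_AE) (auto simp: f_def)
    also have "\<dots> = h y"
      unfolding c_def using pos y by (intro nn_integral_inverse_mass[OF \<nu>h]) auto
    finally show "h y = (\<integral>\<^sup>+ g. f (prod.swap g) \<partial>\<nu>h y)" by simp
  qed
  also have "\<dots> = (\<integral>\<^sup>+ y. (\<integral>\<^sup>+ g. f g * ?d g \<partial>\<nu>h y) \<partial>M)"
    by (rule quasi_invariant_nn_integral[OF \<delta> \<nu>h M qi fm])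
  also have "\<dots> = direct_value \<delta> \<nu>h M \<nu>"
    unfolding direct_value_def
  proof (rule nn_integral_cong)
    fix y assume "y \<in> space M"
    then have y: "y \<in> X" by (simp add: sp)
    obtain F where F: "F \<in> borel_measurable borel" "\<And>g. g \<in> G \<Longrightarrow> F g = ?d g"
      using borel_measurable_extends[OF dm] by auto
    have "(\<integral>\<^sup>+ g. f g * ?d g \<partial>\<nu>h y) =
        (\<integral>\<^sup>+ g. inverse (c y) * (\<integral>\<^sup>+ h. F (fst h, y) \<partial>\<rho> (fst g)) \<partial>\<nu>h y)"
    proof (rule nn_integral_cong_AE)
      show "AE g in \<nu>h y. f g * ?d g = inverse (c y) * (\<integral>\<^sup>+ h. F (fst h, y) \<partial>\<rho> (fst g))"
        using conv_inner_AE[OF k \<rho> y]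
      proof eventually_elim
        case (elim g)
        then have g: "(fst g, y) \<in> G" "g = (fst g, y)"
          and inner: "AE h in \<rho> (fst g). (fst h, fst g) \<in> G \<and> h = (fst h, fst g) \<and> (fst h, y) \<in> G"
          by auto
        have x: "fst g \<in> X" using groupoid_in_X g by blast
        have "h (fst g) * ?d g = (\<integral>\<^sup>+ h. ?d h * ?d g \<partial>\<rho> (fst g))"
          unfolding h_def using dm
          by (intro nn_integral_multc[symmetric]) (simp add: kernel_measurable_iff[OF \<rho> x])
        also have "\<dots> = (\<integral>\<^sup>+ h. F (fst h, y) \<partial>\<rho> (fst g))"
        proof (rule nn_integral_cong_AE)
          show "AE h in \<rho> (fst g). ?d h * ?d g = F (fst h, y)"
            using inner
          proof eventually_elim
            case (elim h)
            then have "?d (fst h, y) = ?d h * ?d g"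
              using modular_inverse_mult[OF \<delta>, of "fst h" "fst g" y] g by metis
            then show ?case using elim F(2) by simp
          qed
        qed
        finally have "h (fst g) * ?d g = (\<integral>\<^sup>+ h. F (fst h, y) \<partial>\<rho> (fst g))" .
        moreover have "f g * ?d g = inverse (c y) * (h (fst g) * ?d g)"
          using transverse_mass_eq[OF \<nu>h g(1)] by (simp add: f_def c_def mult_ac)
        ultimately show ?case by simp
      qed
    qed
    also have "\<dots> = inverse (c y) * (\<integral>\<^sup>+ g. (\<integral>\<^sup>+ h. F (fst h, y) \<partial>\<rho> (fst g)) \<partial>\<nu>h y)"
      by (intro nn_integral_cmult)
        (simp add: kernel_measurable_iff[OF k y] conv_inner_measurable[OF \<rho> F(1)])
    also have "(\<integral>\<^sup>+ g. (\<integral>\<^sup>+ h. F (fst h, y) \<partial>\<rho> (fst g)) \<partial>\<nu>h y) =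
        (\<integral>\<^sup>+ g. (\<integral>\<^sup>+ h. ?d (fst h, y) \<partial>\<rho> (fst g)) \<partial>\<nu>h y)"
      by (rule conv_integral_cong[OF k \<rho> y F(2)])
    also have "\<dots> = (\<integral>\<^sup>+ g. ?d g \<partial>\<nu> y)"
      unfolding conv[OF y] by (rule nn_integral_kernel_conv[OF k \<rho> y dm, symmetric])
    finally show "(\<integral>\<^sup>+ g. f g * ?d g \<partial>\<nu>h y) =
        inverse (emeasure (\<nu>h y) G) * (\<integral>\<^sup>+ g. ?d g \<partial>\<nu> y)" by (simp add: c_def)
  qed
  finally show ?thesis .
qed

lemma kernel_kernel_scale:
  assumes \<delta>: "modular_function G \<delta>" and \<kappa>: "kernel X G \<kappa>"
  shows "kernel X G (kernel_scale \<delta> \<kappa>)"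
proof -
  have dm: "(\<lambda>g. ennreal (\<delta> g)) \<in> borel_measurable (borel_on G)"
    using \<delta> by (auto simp: modular_function_def)
  show ?thesis unfolding kernel_def
  proof (intro conjI ballI)
    fix y assume y: "y \<in> X"
    show "sets (kernel_scale \<delta> \<kappa> y) = sets (borel_on G)"
      using \<kappa> y by (simp add: kernel_def kernel_scale_def)
    have "(\<lambda>g. ennreal (\<delta> g)) \<in> borel_measurable (\<kappa> y)"
      using dm by (simp add: kernel_measurable_iff[OF \<kappa> y])
    moreover have "AE g in \<kappa> y. snd g = y" using \<kappa> y by (simp add: kernel_def)
    ultimately show "AE g in kernel_scale \<delta> \<kappa> y. snd g = y"
      unfolding kernel_scale_def by (subst AE_density) (auto elim: eventually_mono)
  next
    fix A assume A: "A \<in> sets (borel_on G)"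
    have "(\<lambda>g. ennreal (\<delta> g) * indicator A g) \<in> borel_measurable (borel_on G)"
      using dm A by measurable
    from borel_measurable_kernel_nn_integral[OF \<kappa> this]
    show "(\<lambda>y. emeasure (kernel_scale \<delta> \<kappa> y) A) \<in> borel_measurable (borel_on X)"
    proof (subst measurable_cong[where g = "\<lambda>y. \<integral>\<^sup>+ g. ennreal (\<delta> g) * indicator A g \<partial>\<kappa> y"])
      fix y assume "y \<in> space (borel_on X)"
      then have y: "y \<in> X" by (simp add: space_restrict_space)
      show "emeasure (kernel_scale \<delta> \<kappa> y) A = (\<integral>\<^sup>+ g. ennreal (\<delta> g) * indicator A g \<partial>\<kappa> y)"
        unfolding kernel_scale_def using dm A \<kappa> y
        by (intro emeasure_density) (auto simp: kernel_measurable_iff[OF \<kappa> y] kernel_def)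
    qed
  qed
qed

text \<open>The density \<open>\<delta>(s,x)\<close> cancels against \<open>\<delta>(s,y)\<^sup>-\<^sup>1 = \<delta>(s,x)\<^sup>-\<^sup>1 \<delta>(x,y)\<^sup>-\<^sup>1\<close>; what remains is
  constant for \<open>\<kappa> x\<close>, which has mass one.  The inner integrals therefore agree at every single \<open>y\<close>.\<close>

lemma direct_value_conv_invariant:
  assumes \<delta>: "modular_function G \<delta>" and M: "sets M = sets (borel_on X)"
    and \<kappa>: "kernel X G \<kappa>" and norm: "\<And>y. y \<in> X \<Longrightarrow> emeasure (\<kappa> y) G = 1"
    and \<nu>1: "kernel X G \<nu>1"
    and conv: "\<And>y. y \<in> X \<Longrightarrow> kernel_conv G \<nu>1 (kernel_scale \<delta> \<kappa>) y = \<nu>2 y"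
  shows "direct_value \<delta> \<nu>h M \<nu>1 = direct_value \<delta> \<nu>h M \<nu>2"
  unfolding direct_value_def
proof (rule nn_integral_cong)
  fix y assume "y \<in> space M"
  then have y: "y \<in> X" using sets_eq_imp_space_eq[OF M] by (simp add: space_restrict_space)
  let ?d = "\<lambda>g. ennreal (inverse (\<delta> g))"
  have dm: "(\<lambda>g. ennreal (\<delta> g)) \<in> borel_measurable (borel_on G)"
    using \<delta> by (auto simp: modular_function_def)
  note im = modular_inverse_measurable[OF \<delta>]
  note s = kernel_kernel_scale[OF \<delta> \<kappa>]
  obtain F where F: "F \<in> borel_measurable borel" "\<And>g. g \<in> G \<Longrightarrow> F g = ?d g"
    using borel_measurable_extends[OF im] by auto
  have "(\<integral>\<^sup>+ g. ?d g \<partial>\<nu>2 y) = (\<integral>\<^sup>+ g. (\<integral>\<^sup>+ h. ?d (fst h, y) \<partial>kernel_scale \<delta> \<kappa> (fst g)) \<partial>\<nu>1 y)"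
    unfolding conv[OF y, symmetric] by (rule nn_integral_kernel_conv[OF \<nu>1 s y im])
  also have "\<dots> = (\<integral>\<^sup>+ g. (\<integral>\<^sup>+ h. F (fst h, y) \<partial>kernel_scale \<delta> \<kappa> (fst g)) \<partial>\<nu>1 y)"
    by (rule conv_integral_cong[OF \<nu>1 s y]) (simp add: F(2))
  also have "\<dots> = (\<integral>\<^sup>+ g. ?d g \<partial>\<nu>1 y)"
  proof (rule nn_integral_cong_AE)
    show "AE g in \<nu>1 y. (\<integral>\<^sup>+ h. F (fst h, y) \<partial>kernel_scale \<delta> \<kappa> (fst g)) = ?d g"
      using conv_inner_AE[OF \<nu>1 \<kappa> y]
    proof eventually_elim
      case (elim g)
      then have g: "(fst g, y) \<in> G" "g = (fst g, y)"
        and inner: "AE h in \<kappa> (fst g). (fst h, fst g) \<in> G \<and> h = (fst h, fst g) \<and> (fst h, y) \<in> G"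
        by auto
      have x: "fst g \<in> X" using groupoid_in_X g by blast
      have "(\<integral>\<^sup>+ h. F (fst h, y) \<partial>kernel_scale \<delta> \<kappa> (fst g)) =
          (\<integral>\<^sup>+ h. ennreal (\<delta> h) * F (fst h, y) \<partial>\<kappa> (fst g))"
        unfolding kernel_scale_def using dm section_measurable[OF F(1)]
        by (intro nn_integral_density) (simp_all add: kernel_measurable_iff[OF \<kappa> x])
      also have "\<dots> = (\<integral>\<^sup>+ h. ?d g \<partial>\<kappa> (fst g))"
      proof (rule nn_integral_cong_AE)
        show "AE h in \<kappa> (fst g). ennreal (\<delta> h) * F (fst h, y) = ?d g"
          using inner
        proof eventually_elim
          case (elim h)
          then have "?d (fst h, y) = ?d h * ?d g"
            using modular_inverse_mult[OF \<delta>, of "fst h" "fst g" y] g by metis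
          moreover have "0 < \<delta> h" using \<delta> elim by (metis modular_function_def)
          then have "ennreal (\<delta> h) * ?d h = 1" by (simp add: ennreal_mult[symmetric])
          ultimately show ?case using elim F(2)[of "(fst h, y)"] by (simp add: mult.assoc[symmetric])
        qed
      qed
      also have "\<dots> = ?d g" by (simp add: kernel_space[OF \<kappa> x] norm[OF x])
      finally show ?case .
    qed
  qed
  finally show "inverse (emeasure (\<nu>h y) G) * (\<integral>\<^sup>+ g. ?d g \<partial>\<nu>1 y) =
      inverse (emeasure (\<nu>h y) G) * (\<integral>\<^sup>+ g. ?d g \<partial>\<nu>2 y)" by simp
qed

lemma nn_integral_kernel_combination:
  assumes k: "kernel X G \<nu>1" "kernel X G \<nu>2" "kernel X G \<nu>" and y: "y \<in> X"
    and eq: "\<And>A. A \<in> sets (borel_on G) \<Longrightarrow>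
      emeasure (\<nu> y) A = a * emeasure (\<nu>1 y) A + b * emeasure (\<nu>2 y) A"
    and \<phi>: "\<phi> \<in> borel_measurable (borel_on G)"
  shows "(\<integral>\<^sup>+ g. \<phi> g \<partial>\<nu> y) = a * (\<integral>\<^sup>+ g. \<phi> g \<partial>\<nu>1 y) + b * (\<integral>\<^sup>+ g. \<phi> g \<partial>\<nu>2 y)"
proof (rule nn_integral_unique_functional[symmetric,
      of \<phi> "\<nu> y" "\<lambda>u. a * (\<integral>\<^sup>+ g. u g \<partial>\<nu>1 y) + b * (\<integral>\<^sup>+ g. u g \<partial>\<nu>2 y)"])
  note meas = kernel_measurable_iff[OF k(1) y] kernel_measurable_iff[OF k(2) y]
    kernel_measurable_iff[OF k(3) y]
  have sets: "sets (\<nu>1 y) = sets (borel_on G)" "sets (\<nu>2 y) = sets (borel_on G)"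
    "sets (\<nu> y) = sets (borel_on G)" using k y by (auto simp: kernel_def)
  show "\<phi> \<in> borel_measurable (\<nu> y)" using \<phi> by (simp add: meas)
  show "a * (\<integral>\<^sup>+ g. u g \<partial>\<nu>1 y) + b * (\<integral>\<^sup>+ g. u g \<partial>\<nu>2 y) =
      a * (\<integral>\<^sup>+ g. v g \<partial>\<nu>1 y) + b * (\<integral>\<^sup>+ g. v g \<partial>\<nu>2 y)"
    if "\<And>g. g \<in> space (\<nu> y) \<Longrightarrow> u g = v g" for u v :: "'a \<times> 'a \<Rightarrow> ennreal"
  proof -
    have "(\<integral>\<^sup>+ g. u g \<partial>\<nu>1 y) = (\<integral>\<^sup>+ g. v g \<partial>\<nu>1 y)" "(\<integral>\<^sup>+ g. u g \<partial>\<nu>2 y) = (\<integral>\<^sup>+ g. v g \<partial>\<nu>2 y)"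
      using that k y by (auto simp: kernel_space intro!: nn_integral_cong)
    then show ?thesis by simp
  qed
  show "a * (\<integral>\<^sup>+ g. indicator A g \<partial>\<nu>1 y) + b * (\<integral>\<^sup>+ g. indicator A g \<partial>\<nu>2 y) = emeasure (\<nu> y) A"
    if "A \<in> sets (\<nu> y)" for A
    using that eq[of A] by (simp add: sets)
  show "a * (\<integral>\<^sup>+ g. c * u g \<partial>\<nu>1 y) + b * (\<integral>\<^sup>+ g. c * u g \<partial>\<nu>2 y) =
      c * (a * (\<integral>\<^sup>+ g. u g \<partial>\<nu>1 y) + b * (\<integral>\<^sup>+ g. u g \<partial>\<nu>2 y))"
    if "u \<in> borel_measurable (\<nu> y)" for c u
    using that by (simp add: meas nn_integral_cmult distrib_left mult_ac)
  show "a * (\<integral>\<^sup>+ g. u g + v g \<partial>\<nu>1 y) + b * (\<integral>\<^sup>+ g. u g + v g \<partial>\<nu>2 y) =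
      a * (\<integral>\<^sup>+ g. u g \<partial>\<nu>1 y) + b * (\<integral>\<^sup>+ g. u g \<partial>\<nu>2 y) +
      (a * (\<integral>\<^sup>+ g. v g \<partial>\<nu>1 y) + b * (\<integral>\<^sup>+ g. v g \<partial>\<nu>2 y))"
    if "u \<in> borel_measurable (\<nu> y)" "v \<in> borel_measurable (\<nu> y)" for u v
    using that by (simp add: meas nn_integral_add distrib_left add_ac)
  show "a * (\<integral>\<^sup>+ g. (SUP i. U i g) \<partial>\<nu>1 y) + b * (\<integral>\<^sup>+ g. (SUP i. U i g) \<partial>\<nu>2 y) =
      (SUP i. a * (\<integral>\<^sup>+ g. U i g \<partial>\<nu>1 y) + b * (\<integral>\<^sup>+ g. U i g \<partial>\<nu>2 y))"
    if U: "\<And>i::nat. U i \<in> borel_measurable (\<nu> y)" and mono: "incseq U" for U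
  proof -
    have inc: "incseq (\<lambda>i. \<integral>\<^sup>+ g. U i g \<partial>N)" for N
      using mono by (auto simp: incseq_def le_fun_def intro!: nn_integral_mono)
    have "(\<integral>\<^sup>+ g. (SUP i. U i g) \<partial>\<nu>1 y) = (SUP i. \<integral>\<^sup>+ g. U i g \<partial>\<nu>1 y)"
      "(\<integral>\<^sup>+ g. (SUP i. U i g) \<partial>\<nu>2 y) = (SUP i. \<integral>\<^sup>+ g. U i g \<partial>\<nu>2 y)"
      using U mono by (auto simp: meas intro!: nn_integral_monotone_convergence_SUP)
    moreover have "incseq (\<lambda>i. a * (\<integral>\<^sup>+ g. U i g \<partial>\<nu>1 y))" "incseq (\<lambda>i. b * (\<integral>\<^sup>+ g. U i g \<partial>\<nu>2 y))"
      using inc[of "\<nu>1 y"] inc[of "\<nu>2 y"] by (auto simp: incseq_def intro: mult_left_mono)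
    ultimately show ?thesis by (simp add: ennreal_SUP_add SUP_mult_left_ennreal)
  qed
qed

lemma direct_value_combination:
  assumes \<delta>: "modular_function G \<delta>" and \<nu>h: "kernel X G \<nu>h"
    and M: "sets M = sets (borel_on X)"
    and k: "kernel X G \<nu>1" "kernel X G \<nu>2" "kernel X G \<nu>"
    and eq: "\<And>y A. y \<in> X \<Longrightarrow> A \<in> sets (borel_on G) \<Longrightarrow>
      emeasure (\<nu> y) A = a * emeasure (\<nu>1 y) A + b * emeasure (\<nu>2 y) A"
  shows "direct_value \<delta> \<nu>h M \<nu> = a * direct_value \<delta> \<nu>h M \<nu>1 + b * direct_value \<delta> \<nu>h M \<nu>2"
proof -
  have sp: "space M = X" using sets_eq_imp_space_eq[OF M] by (simp add: space_restrict_space)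
  let ?I = "\<lambda>\<nu> y. inverse (emeasure (\<nu>h y) G) * (\<integral>\<^sup>+ g. ennreal (inverse (\<delta> g)) \<partial>\<nu> y)"
  note im = modular_inverse_measurable[OF \<delta>]
  have meas: "?I \<kappa> \<in> borel_measurable M" if "kernel X G \<kappa>" for \<kappa>
    using borel_measurable_kernel_nn_integral[OF that im] kernel_mass_measurable[OF \<nu>h] M
    by (simp cong: measurable_cong_sets)
  have "direct_value \<delta> \<nu>h M \<nu> = (\<integral>\<^sup>+ y. a * ?I \<nu>1 y + b * ?I \<nu>2 y \<partial>M)"
    unfolding direct_value_def
    by (intro nn_integral_cong)
      (simp add: sp nn_integral_kernel_combination[OF k _ eq im] distrib_left mult_ac)
  also have "\<dots> = a * direct_value \<delta> \<nu>h M \<nu>1 + b * direct_value \<delta> \<nu>h M \<nu>2"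
    unfolding direct_value_def using meas[OF k(1)] meas[OF k(2)]
    by (simp add: nn_integral_add nn_integral_cmult)
  finally show ?thesis .
qed

end

theorem theorem66:
  fixes X :: "'a::topological_space set"
    and G :: "('a \<times> 'a) set"
    and \<delta> :: "'a \<times> 'a \<Rightarrow> real"
    and \<nu>h :: "'a \<Rightarrow> ('a \<times> 'a) measure"
    and M :: "'a measure"
  assumes "base_space X"
    and "measurable_groupoid X G"
    and "modular_function G \<delta>"
    and "transverse_function X G \<nu>h"
    and "\<forall>y\<in>X. emeasure (\<nu>h y) G \<noteq> 0"
    and "prob_space M" and "sets M = sets (borel_on X)"
    and "quasi_invariant G \<delta> \<nu>h M"
  shows "(\<forall>\<nu>. transverse_function X G \<nu> \<longrightarrow>
            (\<exists>\<rho>. factors_through X G \<nu>h \<nu> \<rho>) \<and>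
            (\<forall>\<rho>1 \<rho>2. factors_through X G \<nu>h \<nu> \<rho>1 \<longrightarrow> factors_through X G \<nu>h \<nu> \<rho>2 \<longrightarrow>
               Lambda_val \<delta> M \<rho>1 = Lambda_val \<delta> M \<rho>2) \<and>
            (\<forall>\<rho>. factors_through X G \<nu>h \<nu> \<rho> \<longrightarrow>
               Lambda X G \<delta> \<nu>h M \<nu> = Lambda_val \<delta> M \<rho>)) \<and>
         transverse_measure X G \<delta> (Lambda X G \<delta> \<nu>h M)"
proof -
  note gr = assms(2)
  note ex = transverse_factors[OF gr assms(4,5)]
  note val = Lambda_val_eq_direct_value[OF gr assms(3-8)]
  note ker = transverse_kernel[OF gr]
  have eq_val: "Lambda X G \<delta> \<nu>h M \<nu> = Lambda_val \<delta> M \<rho>" if "factors_through X G \<nu>h \<nu> \<rho>" for \<nu> \<rho>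
    unfolding Lambda_def using that val by (intro the_equality) metis+
  have direct: "Lambda X G \<delta> \<nu>h M \<nu> = direct_value G \<delta> \<nu>h M \<nu>" if "transverse_function X G \<nu>" for \<nu>
    using eq_val[OF ex[OF that]] val[OF ex[OF that]] by simp
  have "transverse_measure X G \<delta> (Lambda X G \<delta> \<nu>h M)"
    unfolding transverse_measure_def
  proof (intro conjI allI impI)
    fix \<nu>1 \<nu>2 \<nu> and a b :: real
    assume t: "transverse_function X G \<nu>1" "transverse_function X G \<nu>2" "transverse_function X G \<nu>"
      and "\<forall>y\<in>X. \<forall>A\<in>sets (borel_on G).
        emeasure (\<nu> y) A = ennreal a * emeasure (\<nu>1 y) A + ennreal b * emeasure (\<nu>2 y) A"
    then show "Lambda X G \<delta> \<nu>h M \<nu> =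
        ennreal a * Lambda X G \<delta> \<nu>h M \<nu>1 + ennreal b * Lambda X G \<delta> \<nu>h M \<nu>2"
      using direct_value_combination[OF gr assms(3) ker[OF assms(4)] assms(7) ker[OF t(1)] ker[OF t(2)] ker[OF t(3)]]
      by (simp add: direct)
  next
    fix \<kappa> \<nu>1 \<nu>2
    assume \<kappa>: "kernel X G \<kappa>" "\<forall>y\<in>X. emeasure (\<kappa> y) G = 1"
      and t: "transverse_function X G \<nu>1" "transverse_function X G \<nu>2"
      and conv: "\<forall>y\<in>X. kernel_conv G \<nu>1 (kernel_scale \<delta> \<kappa>) y = \<nu>2 y"
    show "Lambda X G \<delta> \<nu>h M \<nu>1 = Lambda X G \<delta> \<nu>h M \<nu>2"
      unfolding direct[OF t(1)] direct[OF t(2)]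
      using \<kappa> conv by (intro direct_value_conv_invariant[OF gr assms(3,7) _ _ ker[OF t(1)]]) auto
  qed
  then show ?thesis using ex eq_val by (metis val)
qed

end
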